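(* Let $M$ be Minkowski space, $\mathcal{H}$ a complex Hilbert space, and $a\mapsto U(a)$ a strongly continuous unitary representation on $\mathcal{H}$ of the translation group of $M$ such that for every future-directed timelike unit vector $a$ the generator $H(a)$ of $t\mapsto U(ta)$ is bounded below (spectrum condition). Fix a family $\mathcal{S}$ of parallel spacelike hyperplanes foliating $M$ (closed under translations), and for each $S\in\mathcal{S}$ a family $\mathcal{F}(S)$ of subsets of $S$ ("spatial sets") containing a covering family of bounded subsets of $S$, with $\mathcal{F}(S+a)=\{\Delta+a:\Delta\in\mathcal{F}(S)\}$ for all $a\in M$. Let $\Delta\mapsto E_\Delta$ assign to each spatial set an effect on $\mathcal{H}$, satisfying: (1) Translation covariance: $U(a)E_\Delta U(a)^{*}=E_{\Delta+a}$ for all $a\in M$ and all spatial sets $\Delta$; (2') Localizability (probabilistic form): for each $S\in\mathcal{S}$, all $\Delta_1,\Delta_2\in\mathcal{F}(S)$ with $\Delta_1\cap\Delta_2=\emptyset$, and every unit vector $\varphi\in\mathcal{H}$, if $\langle\varphi|E_{\Delta_1}\varphi\rangle=1$ then $\langle\varphi|E_{\Delta_2}\varphi\rangle=0$; (3) Local commutativity: for $S_1,S_2\in\mathcal{S}$, $\Delta_1\in\mathcal{F}(S_1)$, $\Delta_2\in\mathcal{F}(S_2)$ spacelike separated, $E_{\Delta_1}E_{\Delta_2}=E_{\Delta_2}E_{\Delta_1}$. Then $P^{(1)}_\Delta=0$ for every bounded spatial set $\Delta$, i.e. no effect $E_\Delta$ with $\Delta$ bounded has eigenvalue $1$.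
   Context: An effect is a bounded operator $E$ on $\mathcal{H}$ with $0\le E\le I$. For an effect $E_\Delta$, $P^{(1)}_\Delta$ and $P^{(0)}_\Delta$ denote the spectral projections of $E_\Delta$ onto its eigenspaces for eigenvalues $1$ and $0$ respectively (i.e. onto $\ker(I-E_\Delta)$ and $\ker E_\Delta$). Two subsets $\Delta_1,\Delta_2\subset M$ are spacelike separated if $x-y$ is spacelike for all $x\in\Delta_1$, $y\in\Delta_2$. A subset of a hyperplane $S$ is bounded if it is bounded in the Euclidean metric induced on $S$. *)

theory Defs
  imports "HOL-Analysis.Analysis"
begin

text \<open>A complex Hilbert space: a complete normed space with a complex scalar
multiplication (extending the real one) and an inner product that is conjugate
linear in the first and linear in the second argument (physics convention,
matching the bra-ket notation of the paper), inducing the norm.\<close>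

class chilbert = real_normed_vector + complete_space +
  fixes scaleC :: "complex \<Rightarrow> 'a \<Rightarrow> 'a" (infixr \<open>*\<^sub>C\<close> 75)
  fixes cinner :: "'a \<Rightarrow> 'a \<Rightarrow> complex"
  assumes scaleC_add_right: "c *\<^sub>C (x + y) = c *\<^sub>C x + c *\<^sub>C y"
    and scaleC_add_left: "(c + d) *\<^sub>C x = c *\<^sub>C x + d *\<^sub>C x"
    and scaleC_scaleC: "c *\<^sub>C (d *\<^sub>C x) = (c * d) *\<^sub>C x"
    and scaleC_one: "1 *\<^sub>C x = x"
    and scaleR_scaleC: "scaleR r x = complex_of_real r *\<^sub>C x"
    and cinner_commute: "cinner x y = cnj (cinner y x)"
    and cinner_add_right: "cinner x (y + z) = cinner x y + cinner x z"
    and cinner_scaleC_right: "cinner x (c *\<^sub>C y) = c * cinner x y"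
    and cinner_self_norm: "cinner x x = complex_of_real ((norm x)\<^sup>2)"

definition clinear_op :: "('a::chilbert \<Rightarrow> 'a) \<Rightarrow> bool" where
  "clinear_op A \<longleftrightarrow> (\<forall>x y. A (x + y) = A x + A y) \<and> (\<forall>c x. A (c *\<^sub>C x) = c *\<^sub>C A x)"

definition bounded_op :: "('a::chilbert \<Rightarrow> 'a) \<Rightarrow> bool" where
  "bounded_op A \<longleftrightarrow> clinear_op A \<and> (\<exists>K. \<forall>x. norm (A x) \<le> K * norm x)"

definition effect :: "('a::chilbert \<Rightarrow> 'a) \<Rightarrow> bool" where
  "effect E \<longleftrightarrow> bounded_op E \<and>
     (\<forall>x. Im (cinner x (E x)) = 0 \<and> 0 \<le> Re (cinner x (E x)) \<and> Re (cinner x (E x)) \<le> Re (cinner x x))"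

definition unitary :: "('a::chilbert \<Rightarrow> 'a) \<Rightarrow> bool" where
  "unitary U \<longleftrightarrow> clinear_op U \<and> surj U \<and> (\<forall>x y. cinner (U x) (U y) = cinner x y)"

text \<open>Eigenspace of A for eigenvalue c; the spectral projection P^(1) of an
effect is the orthogonal projection onto eigenspace E 1 = ker (I - E), so
P^(1) = 0 iff this eigenspace is {0}.\<close>
definition eigenspace :: "('a::chilbert \<Rightarrow> 'a) \<Rightarrow> complex \<Rightarrow> 'a set" where
  "eigenspace A c = {x. A x = c *\<^sub>C x}"

type_synonym mink = "real ^ 4"

definition mink_form :: "mink \<Rightarrow> mink \<Rightarrow> real" where
  "mink_form x y = x$0 * y$0 - x$1 * y$1 - x$2 * y$2 - x$3 * y$3"

definition timelike :: "mink \<Rightarrow> bool" where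
  "timelike x \<longleftrightarrow> mink_form x x > 0"

definition spacelike :: "mink \<Rightarrow> bool" where
  "spacelike x \<longleftrightarrow> mink_form x x < 0"

definition future_timelike_unit :: "mink \<Rightarrow> bool" where
  "future_timelike_unit a \<longleftrightarrow> mink_form a a = 1 \<and> a$0 > 0"

definition translate :: "mink set \<Rightarrow> mink \<Rightarrow> mink set" where
  "translate D a = (\<lambda>x. x + a) ` D"

definition spacelike_separated :: "mink set \<Rightarrow> mink set \<Rightarrow> bool" where
  "spacelike_separated D1 D2 \<longleftrightarrow> (\<forall>x\<in>D1. \<forall>y\<in>D2. spacelike (x - y))"

definition spacelike_foliation :: "mink set set \<Rightarrow> bool" where
  "spacelike_foliation Hyp \<longleftrightarrow>
     (\<exists>n. timelike n \<and> Hyp = range (\<lambda>c::real. {x. mink_form n x = c}))"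

definition strongly_cont_unitary_rep :: "(mink \<Rightarrow> 'a::chilbert \<Rightarrow> 'a) \<Rightarrow> bool" where
  "strongly_cont_unitary_rep U \<longleftrightarrow>
     (\<forall>a. unitary (U a)) \<and> U 0 = id \<and> (\<forall>a b. U (a + b) = U a \<circ> U b) \<and>
     (\<forall>x. continuous_on UNIV (\<lambda>a. U a x))"

text \<open>Graph of the (self-adjoint, generally unbounded) generator H(a) of the
one-parameter group t \<mapsto> U(ta) = exp(i t H(a)):
phi is in the domain and H(a) phi = psi iff (U(ta) phi - phi)/(i t) \<rightarrow> psi as t \<rightarrow> 0.\<close>
definition generator :: "(mink \<Rightarrow> 'a::chilbert \<Rightarrow> 'a) \<Rightarrow> mink \<Rightarrow> 'a \<Rightarrow> 'a \<Rightarrow> bool" where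
  "generator U a \<phi> \<psi> \<longleftrightarrow>
     ((\<lambda>t::real. inverse (\<i> * complex_of_real t) *\<^sub>C (U (t *\<^sub>R a) \<phi> - \<phi>)) \<longlongrightarrow> \<psi>) (at 0)"

definition generator_bounded_below :: "(mink \<Rightarrow> 'a::chilbert \<Rightarrow> 'a) \<Rightarrow> mink \<Rightarrow> bool" where
  "generator_bounded_below U a \<longleftrightarrow>
     (\<exists>c::real. \<forall>\<phi> \<psi>. generator U a \<phi> \<psi> \<longrightarrow> c * (norm \<phi>)\<^sup>2 \<le> Re (cinner \<phi> \<psi>))"

end

theory Submission
  imports Defs "HOL-Complex_Analysis.Complex_Analysis" "HOL-Probability.Distributions"
begin

text \<open>Let \<open>P\<^sub>\<Delta>\<close> be the projection onto the eigenvalue-1 space of \<open>E\<^sub>\<Delta>\<close>; it is the strong limit of the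
  powers of \<open>E\<^sub>\<Delta>\<close>, hence commutes with whatever commutes with \<open>E\<^sub>\<Delta>\<close>. For a sufficiently long spatial
  vector \<open>a\<close>, localizability gives \<open>P\<^bsub>\<Delta>+a\<^esub> P\<^sub>\<Delta> = 0\<close>, and for a timelike unit vector \<open>m\<close> and small
  \<open>t\<close> the sets \<open>\<Delta>\<close> and \<open>\<Delta> + a + t m\<close> are still spacelike separated, so the projections commute.
  Borchers' theorem, which rests on the boundedness below of the energy, upgrades this to
  \<open>P\<^bsub>\<Delta>+a+tm\<^esub> P\<^sub>\<Delta> = 0\<close> for all \<open>t\<close>. If \<open>n\<close> is the unit normal of the foliation, then for large
  \<open>t\<close> the vector \<open>t n - a\<close> is timelike, so \<open>P\<^bsub>\<Delta>+tn\<^esub> P\<^sub>\<Delta> = 0\<close>; hence \<open>\<langle>x, U (t n) x\<rangle> = 0\<close> for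
  all large \<open>t\<close> when \<open>P\<^sub>\<Delta> x = x\<close>. This function is the boundary value of a holomorphic
  function on a strip above the real axis, so it vanishes at \<open>t = 0\<close> as well, i.e. \<open>x = 0\<close>.\<close>

subsection \<open>Hilbert space operators\<close>

text \<open>Passing from effects to projections is forced by Borchers' argument: it merges several
  nearby translates of one operator into a single one, which needs idempotence. The detour through
  \<open>a\<close> is needed because a nonempty \<open>\<Delta>\<close> is never spacelike separated
  from its translate by a timelike vector, so nothing is known about commutation there. Once the
  products vanish along every timelike line through \<open>a\<close>, a vector \<open>t n\<close>
  with \<open>t n - a\<close> timelike lies on such a line, whose direction varies with
  \<open>t\<close>.

  The generator H is unbounded and enters only through its graph; exp (- y H) is never formed. Its
  place is taken by entire orbits, obtained by Gaussian smearing, whose norm obeys a differential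
  inequality in Im z. The resulting bound depends on an orbit \<open>\<xi>\<close> only through the
  norm of \<open>\<xi> 0\<close>, hence passes by density to arbitrary vectors.\<close>

instance chilbert \<subseteq> banach ..

lemma cinner_add_left: "cinner (x + y) z = cinner x z + cinner y z"
  by (metis cinner_add_right cinner_commute complex_cnj_add)

lemma cinner_scaleC_left: "cinner (c *\<^sub>C x) y = cnj c * cinner x y"
  by (metis cinner_commute cinner_scaleC_right complex_cnj_mult)

lemma cinner_scaleR_left: "cinner (r *\<^sub>R x) y = r *\<^sub>R cinner x y"
  by (simp add: scaleR_scaleC cinner_scaleC_left scaleR_conv_of_real)

lemma cinner_scaleR_right: "cinner x (r *\<^sub>R y) = r *\<^sub>R cinner x y"
  by (simp add: scaleR_scaleC cinner_scaleC_right scaleR_conv_of_real)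

lemma cinner_zero_left [simp]: "cinner 0 x = 0"
  using cinner_scaleR_left[of 0 x x] by simp

lemma cinner_zero_right [simp]: "cinner x 0 = 0"
  using cinner_scaleR_right[of x 0 x] by simp

lemma cinner_minus_left: "cinner (- x) y = - cinner x y"
  using cinner_scaleR_left[of "-1" x y] by simp

lemma cinner_minus_right: "cinner x (- y) = - cinner x y"
  using cinner_scaleR_right[of x "-1" y] by simp

lemma cinner_diff_left: "cinner (x - y) z = cinner x z - cinner y z"
  using cinner_add_left[of x "- y" z] by (simp add: cinner_minus_left)

lemma cinner_diff_right: "cinner x (y - z) = cinner x y - cinner x z"
  using cinner_add_right[of x y "- z"] by (simp add: cinner_minus_right)

lemma norm_scaleC [simp]: "norm (c *\<^sub>C (x::'a::chilbert)) = cmod c * norm x"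
proof -
  have "complex_of_real ((norm (c *\<^sub>C x))\<^sup>2) = (c * cnj c) * complex_of_real ((norm x)\<^sup>2)"
    by (simp only: cinner_scaleC_left cinner_scaleC_right mult_ac flip: cinner_self_norm)
  also have "\<dots> = complex_of_real ((cmod c * norm x)\<^sup>2)"
    by (simp add: power_mult_distrib flip: complex_norm_square)
  finally have "(norm (c *\<^sub>C x))\<^sup>2 = (cmod c * norm x)\<^sup>2"
    by (simp only: of_real_eq_iff)
  then show ?thesis
    by (simp add: power2_eq_iff_nonneg)
qed

text \<open>Stated for a form that need not be definite, so that it also yields \<open>\<parallel>E x\<parallel>\<^sup>2 \<le> \<langle>x, E x\<rangle>\<close>.\<close>

lemma psd_form_Cauchy_Schwarz:
  fixes q :: "'a::chilbert \<Rightarrow> 'a \<Rightarrow> complex"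
  assumes addl: "\<And>x y z. q (x + y) z = q x z + q y z"
    and addr: "\<And>x y z. q z (x + y) = q z x + q z y"
    and scl: "\<And>c x y. q (c *\<^sub>C x) y = cnj c * q x y"
    and scr: "\<And>c x y. q x (c *\<^sub>C y) = c * q x y"
    and comm: "\<And>x y. q x y = cnj (q y x)"
    and pos: "\<And>x. 0 \<le> Re (q x x)"
  shows "(cmod (q x y))\<^sup>2 \<le> Re (q x x) * Re (q y y)"
proof -
  define b where "b = q x y"
  have qyx: "q y x = cnj b"
    using comm b_def by blast
  have main: "0 \<le> Re (q x x) - 2 * r * (cmod b)\<^sup>2 + r\<^sup>2 * (cmod b)\<^sup>2 * Re (q y y)" for r :: real
  proof -
    \<comment> \<open>The factor \<open>cnj b\<close> turns both cross terms into the real number -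
      r |b|^2, leaving a real quadratic in \<open>r\<close>.\<close>
    define c where "c = - (of_real r * cnj b)"
    have "q (x + c *\<^sub>C y) (x + c *\<^sub>C y) = q x x + c * b + cnj c * cnj b + cnj c * c * q y y"
      by (simp add: addl addr scl scr qyx flip: b_def) (simp add: algebra_simps)
    also have "c * b = - of_real (r * (cmod b)\<^sup>2)"
      using complex_norm_square[of b] by (simp add: c_def mult.assoc mult.commute[of b])
    also have "cnj c * cnj b = - of_real (r * (cmod b)\<^sup>2)"
      using complex_norm_square[of b] by (simp add: c_def mult.assoc)
    also have "cnj c * c = of_real (r\<^sup>2 * (cmod b)\<^sup>2)"
      using complex_norm_square[of b] by (simp add: c_def power2_eq_square mult_ac)
    finally have "Re (q (x + c *\<^sub>C y) (x + c *\<^sub>C y)) =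
        Re (q x x) - 2 * r * (cmod b)\<^sup>2 + r\<^sup>2 * (cmod b)\<^sup>2 * Re (q y y)"
      by (simp add: Re_complex_of_real)
    with pos show ?thesis by metis
  qed
  show ?thesis
  proof (cases "Re (q y y) = 0")
    case True
    have "b = 0"
    proof (rule ccontr)
      assume "b \<noteq> 0"
      then have "0 < (cmod b)\<^sup>2" by simp
      \<comment> \<open>With Re (q y y) = 0 the inequality \<open>main\<close> is linear in
        \<open>r\<close>; this \<open>r\<close> makes its right-hand side equal to -1.\<close>
      moreover have "2 * ((Re (q x x) + 1) / (2 * (cmod b)\<^sup>2)) * (cmod b)\<^sup>2 = Re (q x x) + 1"
        using calculation by simp
      ultimately show False
        using main[of "(Re (q x x) + 1) / (2 * (cmod b)\<^sup>2)"] True by simp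
    qed
    then show ?thesis using pos b_def by simp
  next
    case False
    then have p: "Re (q y y) > 0" using pos[of y] by simp
    have "0 \<le> Re (q x x) - (cmod b)\<^sup>2 / Re (q y y)"
      using main[of "1 / Re (q y y)"] p by (simp add: field_simps power2_eq_square)
    then show ?thesis
      using p by (simp add: b_def field_simps)
  qed
qed

lemma Re_cinner_self: "Re (cinner x x) = (norm x)\<^sup>2"
  by (simp add: cinner_self_norm)

lemma cinner_norm_le: "cmod (cinner x y) \<le> norm x * norm y"
proof -
  have "(cmod (cinner x y))\<^sup>2 \<le> Re (cinner x x) * Re (cinner y y)"
    by (rule psd_form_Cauchy_Schwarz; (rule cinner_commute)?)
      (simp_all add: cinner_add_left cinner_add_right cinner_scaleC_left cinner_scaleC_right
        Re_cinner_self)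
  then have "(cmod (cinner x y))\<^sup>2 \<le> (norm x * norm y)\<^sup>2"
    by (simp add: Re_cinner_self power_mult_distrib)
  then show ?thesis
    by (rule power2_le_imp_le) simp
qed

lemma bounded_bilinear_cinner: "bounded_bilinear cinner"
  by standard (auto simp: cinner_add_left cinner_add_right cinner_scaleR_left cinner_scaleR_right
      intro!: exI[of _ 1] cinner_norm_le)

lemma scaleC_zero_right [simp]: "c *\<^sub>C 0 = (0::'a::chilbert)"
  by (metis mult_zero_right norm_eq_zero norm_scaleC norm_zero)

lemma scaleC_zero_left [simp]: "0 *\<^sub>C x = (0::'a::chilbert)"
  by (metis mult_zero_left norm_eq_zero norm_scaleC norm_zero)

lemma bounded_bilinear_scaleC: "bounded_bilinear (\<lambda>c (x::'a::chilbert). c *\<^sub>C x)"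
  by standard (auto simp: scaleC_add_right scaleC_add_left scaleR_scaleC scaleC_scaleC
      scaleR_conv_of_real mult.commute intro!: exI[of _ 1])

lemmas tendsto_cinner = bounded_bilinear.tendsto[OF bounded_bilinear_cinner]
lemmas tendsto_scaleC = bounded_bilinear.tendsto[OF bounded_bilinear_scaleC]
lemmas continuous_on_scaleC = bounded_bilinear.continuous_on[OF bounded_bilinear_scaleC]

lemma scaleC_diff_right: "c *\<^sub>C (x - y) = c *\<^sub>C x - c *\<^sub>C (y::'a::chilbert)"
  by (rule bounded_bilinear.diff_right[OF bounded_bilinear_scaleC])

lemma scaleC_diff_left: "(c - d) *\<^sub>C x = c *\<^sub>C x - d *\<^sub>C (x::'a::chilbert)"
  by (rule bounded_bilinear.diff_left[OF bounded_bilinear_scaleC])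

section \<open>Contractions and symmetric operators\<close>

definition contraction :: "('a::chilbert \<Rightarrow> 'a) \<Rightarrow> bool" where
  "contraction X \<longleftrightarrow> clinear_op X \<and> (\<forall>x. norm (X x) \<le> norm x)"

definition symmetric_op :: "('a::chilbert \<Rightarrow> 'a) \<Rightarrow> bool" where
  "symmetric_op X \<longleftrightarrow> (\<forall>x y. cinner (X x) y = cinner x (X y))"

lemma clinear_op_add: "clinear_op X \<Longrightarrow> X (x + y) = X x + X y"
  and clinear_op_scaleC: "clinear_op X \<Longrightarrow> X (c *\<^sub>C x) = c *\<^sub>C X x"
  by (auto simp: clinear_op_def)

lemma clinear_op_linear: "clinear_op X \<Longrightarrow> linear X"
  by (rule linearI) (auto simp: clinear_op_def scaleR_scaleC)

lemmas clinear_op_zero = linear_0[OF clinear_op_linear]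
  and clinear_op_diff = linear_diff[OF clinear_op_linear]

lemma contraction_clinear: "contraction X \<Longrightarrow> clinear_op X"
  and contraction_norm_le: "contraction X \<Longrightarrow> norm (X x) \<le> norm x"
  by (auto simp: contraction_def)

lemma contraction_bounded_linear: "contraction X \<Longrightarrow> bounded_linear X"
  by (rule bounded_linear_intro[where K = 1])
    (auto simp: contraction_def clinear_op_def scaleR_scaleC)

lemma contraction_id: "contraction id"
  by (auto simp: contraction_def clinear_op_def)

lemma contraction_comp: "contraction X \<Longrightarrow> contraction Y \<Longrightarrow> contraction (X \<circ> Y)"
  by (auto simp: contraction_def clinear_op_def intro: order_trans)

lemma contraction_tendsto:
  "contraction X \<Longrightarrow> (f \<longlongrightarrow> l) G \<Longrightarrow> ((\<lambda>x. X (f x)) \<longlongrightarrow> X l) G"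
  by (rule bounded_linear.tendsto[OF contraction_bounded_linear])

lemma unitary_cinner: "unitary V \<Longrightarrow> cinner (V x) (V y) = cinner x y"
  by (simp add: unitary_def)

lemma unitary_norm: "unitary V \<Longrightarrow> norm (V x) = norm x"
  by (metis Re_cinner_self norm_ge_zero power2_eq_iff_nonneg unitary_cinner)

lemma unitary_contraction: "unitary V \<Longrightarrow> contraction V"
  by (simp add: contraction_def unitary_norm) (simp add: unitary_def)

text \<open>Polarisation: the quadratic form at x + y relates the imaginary parts of the two cross
  terms, at x + i y their real parts.\<close>

lemma symmetric_op_cinner_imag_zero:
  assumes X: "clinear_op X" and im: "\<And>x. Im (cinner x (X x)) = 0"
  shows "symmetric_op X"
  unfolding symmetric_op_def
proof (intro allI)
  fix x y
  define u v where "u = cinner x (X y)" and "v = cinner y (X x)"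
  have "Im (u + v) = 0"
    using im[of "x + y"] im[of x] im[of y]
    by (simp add: clinear_op_add[OF X] cinner_add_left cinner_add_right u_def v_def)
  moreover have "Re u = Re v"
    using im[of "x + \<i> *\<^sub>C y"] im[of x] im[of y]
    by (simp add: clinear_op_add[OF X] clinear_op_scaleC[OF X] cinner_add_left cinner_add_right
        cinner_scaleC_left cinner_scaleC_right u_def v_def)
  ultimately have "cnj v = u"
    by (simp add: complex_eq_iff)
  then show "cinner (X x) y = cinner x (X y)"
    by (metis cinner_commute u_def v_def)
qed

subsection \<open>The eigenprojection of an effect\<close>

lemma effect_clinear: "effect E \<Longrightarrow> clinear_op E"
  by (simp add: effect_def bounded_op_def)

lemma effect_symmetric: "effect E \<Longrightarrow> symmetric_op E"
  by (rule symmetric_op_cinner_imag_zero) (auto simp: effect_def bounded_op_def)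

text \<open>This is the operator inequality E^2 \<le> E without square roots of operators:
  Cauchy-Schwarz for the form of E at the vectors E x and x, then E \<le> I, then cancellation of a
  factor.\<close>

lemma effect_norm_square_le:
  assumes E: "effect E"
  shows "(norm (E x))\<^sup>2 \<le> Re (cinner x (E x))"
proof -
  have "(cmod (cinner y (E x)))\<^sup>2 \<le> Re (cinner y (E y)) * Re (cinner x (E x))" for x y
  proof (rule psd_form_Cauchy_Schwarz[of "\<lambda>x y. cinner x (E y)"])
    show "cinner x (E y) = cnj (cinner y (E x))" for x y
      using effect_symmetric[OF E] by (metis cinner_commute symmetric_op_def)
  qed (use E in \<open>auto simp: effect_def clinear_op_add[OF effect_clinear[OF E]]
      clinear_op_scaleC[OF effect_clinear[OF E]] cinner_add_left cinner_add_right
      cinner_scaleC_left cinner_scaleC_right\<close>)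
  from this[of "E x" x]
  have "((norm (E x))\<^sup>2)\<^sup>2 \<le> Re (cinner (E x) (E (E x))) * Re (cinner x (E x))"
    by (simp add: cinner_self_norm flip: of_real_power)
  also have "\<dots> \<le> (norm (E x))\<^sup>2 * Re (cinner x (E x))"
    using E unfolding effect_def Re_cinner_self by (intro mult_right_mono) auto
  finally have "(norm (E x))\<^sup>2 * (norm (E x))\<^sup>2 \<le> (norm (E x))\<^sup>2 * Re (cinner x (E x))"
    by (simp only: power2_eq_square)
  then have "(norm (E x))\<^sup>2 \<le> Re (cinner x (E x))" if "E x \<noteq> 0"
    by (rule mult_left_le_imp_le) (use that in simp)
  then show ?thesis
    using E by (cases "E x = 0") (auto simp: effect_def)
qed

lemma effect_contraction:
  assumes "effect E" shows "contraction E"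
proof -
  have "(norm (E x))\<^sup>2 \<le> (norm x)\<^sup>2" for x
    using effect_norm_square_le[OF assms, of x] assms unfolding effect_def Re_cinner_self
    by (meson order_trans)
  then show ?thesis
    using effect_clinear[OF assms] by (simp add: contraction_def power_mono_iff)
qed

lemma contraction_funpow: "contraction E \<Longrightarrow> contraction (E ^^ n)"
  by (induction n) (auto simp: contraction_id contraction_comp id_def[symmetric])

lemma symmetric_op_funpow: "symmetric_op E \<Longrightarrow> symmetric_op (E ^^ n)"
  by (induction n) (auto simp: symmetric_op_def funpow_swap1)

text \<open>The matrix elements \<open>\<langle>x, E\<^sup>n x\<rangle>\<close> decrease, which makes the powers \<open>E\<^sup>n\<close> converge strongly;
  the limit is the spectral projection for the eigenvalue 1.\<close>

definition eigenproj :: "('a::chilbert \<Rightarrow> 'a) \<Rightarrow> 'a \<Rightarrow> 'a" where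
  "eigenproj E x = lim (\<lambda>n. (E ^^ n) x)"

lemma effect_power_tendsto:
  assumes E: "effect E"
  shows "(\<lambda>n. (E ^^ n) x) \<longlonglongrightarrow> eigenproj E x"
proof -
  define a where "a n = Re (cinner x ((E ^^ n) x))" for n
  have sym: "cinner ((E ^^ m) y) z = cinner y ((E ^^ m) z)" for m y z
    using symmetric_op_funpow[OF effect_symmetric[OF E]] by (auto simp: symmetric_op_def)
  have a_add: "Re (cinner ((E ^^ m) x) ((E ^^ n) x)) = a (m + n)" for m n
    by (simp add: sym a_def funpow_add)
  have a_even: "a (2 * m) = (norm ((E ^^ m) x))\<^sup>2" for m
    using a_add[of m m] by (simp add: Re_cinner_self mult_2)
  have a_odd: "a (Suc (2 * m)) = Re (cinner ((E ^^ m) x) (E ((E ^^ m) x)))" for m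
    using a_add[of m "Suc m"] by (simp add: mult_2)
  have a_nonneg: "0 \<le> a n" for n
  proof (cases "even n")
    case True
    then show ?thesis by (auto elim!: evenE simp: a_even)
  next
    case False
    then show ?thesis using E by (auto elim!: oddE simp: a_odd effect_def)
  qed
  \<comment> \<open>From an even to an odd index the decrease is E \<le> I at the vector
    \<open>(E ^^ m) x\<close>; from an odd to an even one it is E^2 \<le> E there.\<close>
  have "a (Suc n) \<le> a n" for n
  proof (cases "even n")
    case True
    then obtain m where n: "n = 2 * m" by (elim evenE)
    show ?thesis
      using E unfolding n a_even a_odd effect_def Re_cinner_self by blast
  next
    case False
    then obtain m where n: "n = Suc (2 * m)" by (auto elim!: oddE)
    have "a (Suc n) = (norm (E ((E ^^ m) x)))\<^sup>2"
      using a_even[of "Suc m"] n by simp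
    then show ?thesis
      using effect_norm_square_le[OF E, of "(E ^^ m) x"] by (simp add: n a_odd)
  qed
  then have "decseq a" by (simp add: decseq_SucI)
  then obtain L where L: "a \<longlonglongrightarrow> L"
    using decseq_convergent[of a 0] a_nonneg by blast
  \<comment> \<open>Distances between powers are second differences of \<open>a\<close>. The
    coefficients 1, -2, 1 cancel the limit \<open>L\<close>, and their absolute values sum to 4,
    whence the tolerance e^2 / 4 below.\<close>
  have dist_sq: "(dist ((E ^^ m) x) ((E ^^ n) x))\<^sup>2 = a (m + m) - 2 * a (m + n) + a (n + n)" for m n
  proof -
    have "(dist ((E ^^ m) x) ((E ^^ n) x))\<^sup>2
        = Re (cinner ((E ^^ m) x - (E ^^ n) x) ((E ^^ m) x - (E ^^ n) x))"
      by (simp add: Re_cinner_self dist_norm)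
    then show ?thesis
      by (simp add: cinner_diff_left cinner_diff_right a_add add.commute)
  qed
  have "Cauchy (\<lambda>n. (E ^^ n) x)"
    unfolding Cauchy_def
  proof (intro allI impI)
    fix e :: real assume e: "e > 0"
    then have "e\<^sup>2 / 4 > 0" by simp
    then obtain M where M: "\<And>n. n \<ge> M \<Longrightarrow> \<bar>a n - L\<bar> < e\<^sup>2 / 4"
      using LIMSEQ_D[OF L] by (metis real_norm_def)
    have "dist ((E ^^ m) x) ((E ^^ n) x) < e" if "m \<ge> M" "n \<ge> M" for m n
    proof -
      have "(dist ((E ^^ m) x) ((E ^^ n) x))\<^sup>2 < e\<^sup>2"
        unfolding dist_sq using M[of "m + m"] M[of "m + n"] M[of "n + n"] that by linarith
      then show ?thesis using e by (simp add: power2_less_imp_less)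
    qed
    then show "\<exists>M. \<forall>m\<ge>M. \<forall>n\<ge>M. dist ((E ^^ m) x) ((E ^^ n) x) < e" by blast
  qed
  then show ?thesis
    by (simp add: eigenproj_def Cauchy_convergent_iff convergent_LIMSEQ_iff)
qed

lemma effect_eigenproj:
  assumes E: "effect E" shows "E (eigenproj E x) = eigenproj E x"
proof (rule LIMSEQ_unique)
  show "(\<lambda>n. (E ^^ Suc n) x) \<longlonglongrightarrow> E (eigenproj E x)"
    using contraction_tendsto[OF effect_contraction[OF E] effect_power_tendsto[OF E]] by simp
  show "(\<lambda>n. (E ^^ Suc n) x) \<longlonglongrightarrow> eigenproj E x"
    using effect_power_tendsto[OF E] by (rule LIMSEQ_Suc)
qed

lemma eigenproj_fixed:
  assumes "E x = x" shows "eigenproj E x = x"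
proof -
  have "(E ^^ n) x = x" for n
    using assms by (induction n) auto
  then show ?thesis by (simp add: eigenproj_def)
qed

lemma eigenproj_idem: "effect E \<Longrightarrow> eigenproj E (eigenproj E x) = eigenproj E x"
  by (simp add: eigenproj_fixed effect_eigenproj)

lemma eigenproj_contraction:
  assumes E: "effect E" shows "contraction (eigenproj E)"
proof -
  note lim = effect_power_tendsto[OF E]
  have c: "contraction (E ^^ n)" for n
    by (intro contraction_funpow effect_contraction E)
  note cl = contraction_clinear[OF c]
  have "eigenproj E (x + y) = eigenproj E x + eigenproj E y" for x y
    using LIMSEQ_unique[OF lim tendsto_add[OF lim lim, of x y, folded clinear_op_add[OF cl]]] .
  moreover have "eigenproj E (k *\<^sub>C x) = k *\<^sub>C eigenproj E x" for k x
    using LIMSEQ_unique[OF lim tendsto_scaleC[OF tendsto_const lim, of k x,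
          folded clinear_op_scaleC[OF cl]]] .
  moreover have "norm (eigenproj E x) \<le> norm x" for x
    by (rule LIMSEQ_le_const2[OF tendsto_norm[OF lim]]) (auto intro: contraction_norm_le[OF c])
  ultimately show ?thesis
    by (simp add: contraction_def clinear_op_def)
qed

lemma eigenproj_symmetric:
  assumes E: "effect E" shows "symmetric_op (eigenproj E)"
  unfolding symmetric_op_def
proof (intro allI)
  fix x y
  have "(\<lambda>n. cinner ((E ^^ n) x) y) \<longlonglongrightarrow> cinner x (eigenproj E y)"
    using tendsto_cinner[OF tendsto_const effect_power_tendsto[OF E], of x y]
      symmetric_op_funpow[OF effect_symmetric[OF E]] by (simp add: symmetric_op_def)
  then show "cinner (eigenproj E x) y = cinner x (eigenproj E y)"
    by (intro LIMSEQ_unique[OF tendsto_cinner[OF effect_power_tendsto[OF E] tendsto_const]])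
qed

lemma eigenproj_commute:
  assumes E: "effect E" and X: "contraction X" and comm: "\<And>x. E (X x) = X (E x)"
  shows "eigenproj E (X x) = X (eigenproj E x)"
proof (rule LIMSEQ_unique)
  have "(E ^^ n) (X x) = X ((E ^^ n) x)" for n
    by (induction n) (auto simp: comm)
  then show "(\<lambda>n. (E ^^ n) (X x)) \<longlonglongrightarrow> X (eigenproj E x)"
    using contraction_tendsto[OF X effect_power_tendsto[OF E]] by simp
qed (rule effect_power_tendsto[OF E])

lemma eigenproj_conj:
  assumes E: "effect E" and V: "contraction V" "\<And>x. W (V x) = x"
    and E': "effect E'" "\<And>x. E' x = V (E (W x))"
  shows "eigenproj E' x = V (eigenproj E (W x))"
proof (rule LIMSEQ_unique[OF LIMSEQ_Suc[OF effect_power_tendsto[OF E'(1)]]])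
  \<comment> \<open>Exponents start at 1: exponent 0 would need \<open>V (W x) = x\<close>, whereas
    only \<open>W (V x) = x\<close> is assumed.\<close>
  have "(E' ^^ Suc n) x = V ((E ^^ Suc n) (W x))" for n
    by (induction n) (auto simp: V E')
  then show "(\<lambda>n. (E' ^^ Suc n) x) \<longlonglongrightarrow> V (eigenproj E (W x))"
    using contraction_tendsto[OF V(1) LIMSEQ_Suc[OF effect_power_tendsto[OF E]]] by simp
qed

text \<open>Via \<open>\<parallel>E y\<parallel>\<^sup>2 \<le> \<langle>y, E y\<rangle>\<close>, a vanishing expectation value already forces \<open>E y = 0\<close>.\<close>

lemma eigenproj_orthogonal:
  assumes E: "effect E" and E': "effect E'"
    and loc: "\<And>\<phi>. norm \<phi> = 1 \<Longrightarrow> cinner \<phi> (E \<phi>) = 1 \<Longrightarrow> cinner \<phi> (E' \<phi>) = 0"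
  shows "eigenproj E' (eigenproj E x) = 0"
proof -
  define y where "y = eigenproj E x"
  have Ey: "E y = y" by (simp add: y_def effect_eigenproj[OF E])
  have "E' y = 0"
  proof (cases "y = 0")
    case True
    then show ?thesis by (simp add: clinear_op_zero[OF effect_clinear[OF E']])
  next
    case False
    define u where "u = (1 / norm y) *\<^sub>R y"
    have nu: "norm u = 1" using False by (simp add: u_def)
    have "E u = u"
      by (simp add: u_def Ey linear_scale[OF clinear_op_linear[OF effect_clinear[OF E]]])
    then have "cinner u (E' u) = 0"
      using nu by (intro loc) (auto simp: cinner_self_norm)
    then have "E' u = 0"
      using effect_norm_square_le[OF E', of u] by simp
    then show ?thesis
      using False by (simp add: u_def linear_scale[OF clinear_op_linear[OF effect_clinear[OF E']]])
  qed
  then have "(E' ^^ Suc n) y = 0" for n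
    by (induction n) (auto simp: clinear_op_zero[OF effect_clinear[OF E']])
  then have "(\<lambda>n. (E' ^^ Suc n) y) \<longlonglongrightarrow> 0" by simp
  then show ?thesis
    unfolding y_def[symmetric]
    by (rule LIMSEQ_unique[OF LIMSEQ_Suc[OF effect_power_tendsto[OF E']]])
qed

subsection \<open>Boundary values of holomorphic functions on a strip\<close>

text \<open>The real axis is included because boundary values are taken there. Height 1 keeps exp (-
  c Im z) below exp |c| whatever the sign of \<open>c\<close>.\<close>

abbreviation half_strip :: "complex set" where
  "half_strip \<equiv> {z. 0 \<le> Im z \<and> Im z < 1}"

abbreviation open_half_strip :: "complex set" where
  "open_half_strip \<equiv> {z. 0 < Im z \<and> Im z < 1}"

lemma open_open_half_strip: "open open_half_strip"
  by (intro open_Collect_conj open_halfspace_Im_gt open_halfspace_Im_lt)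

lemma i_inner_eq_Im: "\<i> \<bullet> z = Im z"
  by (simp add: inner_complex_def)

lemma holomorphic_paste_real_axis:
  assumes S: "open S"
    and hol_low: "l holomorphic_on S \<inter> {z. Im z < 0}"
    and hol_up: "u holomorphic_on S \<inter> {z. 0 < Im z}"
    and cont_low: "continuous_on (S \<inter> {z. Im z \<le> 0}) l"
    and cont_up: "continuous_on (S \<inter> {z. 0 \<le> Im z}) u"
    and agree: "\<And>z. z \<in> S \<Longrightarrow> Im z = 0 \<Longrightarrow> l z = u z"
  shows "(\<lambda>z. if Im z \<le> 0 then l z else u z) holomorphic_on S"
proof (rule holomorphic_on_paste_across_line[OF S, of \<i> _ 0], unfold i_inner_eq_Im)
  show "(\<lambda>z. if Im z \<le> 0 then l z else u z) holomorphic_on S \<inter> {z. Im z < 0}"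
    using hol_low by (rule holomorphic_transform) auto
  show "(\<lambda>z. if Im z \<le> 0 then l z else u z) holomorphic_on S \<inter> {z. 0 < Im z}"
    using hol_up by (rule holomorphic_transform) auto
  show "continuous_on S (\<lambda>z. if Im z \<le> 0 then l z else u z)"
    using cont_low cont_up agree
    by (intro continuous_on_cases_le) (auto simp: Int_def intro: continuous_intros)
qed auto

text \<open>The identity theorem does not apply to zeros on the boundary. But the zero function
  below the interval continues \<open>h\<close> across it, so the zeros become interior ones;
  continuity then returns from the open strip to the whole real axis.\<close>

lemma half_strip_boundary_uniqueness:
  assumes cont: "continuous_on half_strip h" and hol: "h holomorphic_on open_half_strip"
    and r: "0 < r" and zero: "\<And>t. \<bar>t - t0\<bar> < r \<Longrightarrow> h (of_real t) = 0"
  shows "h (of_real t) = 0"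
proof -
  \<comment> \<open>With radius at most 1 the upper half of the ball lies inside the strip, where
    \<open>h\<close> is defined.\<close>
  define d where "d = min r 1"
  define S where "S = open_half_strip \<union> ball (of_real t0) d"
  have d: "0 < d" "d \<le> 1" "d \<le> r" using r by (auto simp: d_def)
  have ball_Im: "\<bar>Im z\<bar> < 1" if "z \<in> ball (of_real t0) d" for z
    using that d abs_Im_le_cmod[of "z - of_real t0"] by (auto simp: dist_norm norm_minus_commute)
  have S_up: "S \<inter> {z. 0 < Im z} = open_half_strip" "S \<inter> {z. 0 \<le> Im z} \<subseteq> half_strip"
    using ball_Im by (fastforce simp: S_def)+
  have openS: "open S" unfolding S_def by (intro open_Un open_open_half_strip) auto
  define k where "k z = (if Im z \<le> 0 then 0 else h z)" for z
  have holk: "k holomorphic_on S"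
    unfolding k_def
  proof (rule holomorphic_paste_real_axis)
    show "open S" by (rule openS)
    show "h holomorphic_on S \<inter> {z. 0 < Im z}" using hol S_up by simp
    show "continuous_on (S \<inter> {z. 0 \<le> Im z}) h" using cont S_up(2) by (rule continuous_on_subset)
    show "0 = h z" if "z \<in> S" "Im z = 0" for z
    proof -
      have z: "z = of_real (Re z)" using that by (simp add: complex_eq_iff)
      have "z \<in> ball (of_real t0) d" using that by (auto simp: S_def)
      then have "\<bar>Re z - t0\<bar> < r"
        using d abs_Re_le_cmod[of "z - of_real t0"] by (auto simp: dist_norm norm_minus_commute)
      then show ?thesis using zero z by metis
    qed
  qed auto
  have conn: "connected S"
    unfolding S_def
  proof (rule connected_Un)
    have "convex ({z. 0 < Im z} \<inter> {z. Im z < 1})"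
      by (intro convex_Int convex_halfspace_Im_gt convex_halfspace_Im_lt)
    then show "connected open_half_strip" by (simp add: convex_connected Int_def)
    have "of_real t0 + \<i> * of_real (d / 2) \<in> open_half_strip \<inter> ball (of_real t0) d"
      using d by (auto simp: dist_norm norm_mult)
    then show "open_half_strip \<inter> ball (of_real t0) d \<noteq> {}" by blast
  qed auto
  define T where "T = ball (complex_of_real t0) d \<inter> {z. Im z < 0}"
  have "of_real t0 - \<i> * of_real (d / 2) \<in> T"
    using d by (auto simp: T_def dist_norm norm_mult)
  then have "T \<noteq> {}" by blast
  moreover have "open T" unfolding T_def by (intro open_Int open_ball open_halfspace_Im_lt)
  moreover have "T \<subseteq> S" by (simp add: T_def S_def subset_iff)
  moreover have "k z = 0" if "z \<in> T" for z using that by (simp add: T_def k_def)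
  ultimately have k0: "k z = 0" if "z \<in> S" for z
    using analytic_continuation_open[OF _ openS _ conn _ holk holomorphic_on_const] that by metis
  \<comment> \<open>The offset 2 keeps the imaginary part strictly below 1 already for n =
    0.\<close>
  define w where "w n = of_real t + \<i> * of_real (1 / real (n + 2))" for n
  have w: "w n \<in> open_half_strip" for n by (simp add: w_def)
  have hw: "h (w n) = 0" for n
    using k0[of "w n"] w[of n] by (auto simp: S_def k_def)
  have "(\<lambda>n. 1 / real (n + 2)) \<longlonglongrightarrow> 0"
    using LIMSEQ_ignore_initial_segment[OF lim_1_over_n, of 2] by simp
  then have "w \<longlonglongrightarrow> of_real t + \<i> * of_real 0"
    unfolding w_def by (intro tendsto_intros)
  then have "w \<longlonglongrightarrow> of_real t" by simp
  then have "(\<lambda>n. h (w n)) \<longlonglongrightarrow> h (of_real t)"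
    using cont w by (intro continuous_on_tendsto_compose[OF cont]) (auto intro!: always_eventually less_imp_le)
  then show ?thesis by (simp add: hw LIMSEQ_const_iff)
qed

text \<open>Dividing out the zeros one at a time; the maximum principle keeps the quotients bounded.\<close>

lemma holomorphic_bound_by_zeros:
  assumes "finite A" "A \<subseteq> ball 0 (r / 4)" "0 < r" "g holomorphic_on ball 0 r"
    and "\<And>z. z \<in> ball 0 r \<Longrightarrow> cmod (g z) \<le> M"
    and "\<And>a. a \<in> A \<Longrightarrow> g a = 0" and "z \<in> ball 0 (r / 4)"
  shows "cmod (g z) \<le> M * (2 / 3) ^ card A"
  using assms
proof (induction A arbitrary: g M rule: finite_induct)
  case empty
  then show ?case by (auto intro: less_trans)
next
  case (insert a A)
  note r = \<open>0 < r\<close>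
  have a: "cmod a < r / 4" using insert.prems by auto
  then have ar: "a \<in> ball 0 r" using r by simp
  define h where "h w = (if w = a then deriv g a else (g w - g a) / (w - a))" for w
  have ga: "g a = 0" using insert.prems by auto
  have gh: "g w = (w - a) * h w" for w
    by (simp add: h_def ga)
  have holh: "h holomorphic_on ball 0 r"
    unfolding h_def using insert.prems ar by (intro pole_lemma) auto
  have bound: "cmod (h w) \<le> M * (4 / (3 * r))" if w: "w \<in> ball 0 r" for w
  proof -
    \<comment> \<open>The bound on \<open>g\<close> is only given inside the ball, so the maximum
      principle is used on circles of radius \<open>\<rho>\<close> < r, where |v - a| is at least
      \<rho> - r/4; then \<open>\<rho>\<close> tends to r.\<close>
    have "cmod (h w) * (\<rho> - r / 4) \<le> M" if "max (cmod w) (r / 4) < \<rho>" "\<rho> < r" for \<rho>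
    proof -
      have sub: "cball 0 \<rho> \<subseteq> ball (0::complex) r" using that by auto
      have "cmod (h w) \<le> M / (\<rho> - r / 4)"
      proof (rule maximum_modulus_frontier[of h "ball 0 \<rho>"])
        show "h holomorphic_on interior (ball 0 \<rho>)"
          using ball_subset_cball sub by (auto intro!: holomorphic_on_subset[OF holh])
        show "continuous_on (closure (ball 0 \<rho>)) h"
          using holomorphic_on_imp_continuous_on[OF holh] sub that r
          by (auto elim: continuous_on_subset)
        show "cmod (h v) \<le> M / (\<rho> - r / 4)" if v: "v \<in> frontier (ball 0 \<rho>)" for v
        proof -
          have nv: "cmod v = \<rho>" using v \<open>max _ _ < \<rho>\<close> r by (auto simp: frontier_ball)
          have "\<rho> - r / 4 \<le> cmod (v - a)"
            using norm_triangle_ineq2[of v a] nv a by linarith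
          moreover have "cmod (v - a) * cmod (h v) \<le> M"
            using insert.prems(4)[of v] nv \<open>\<rho> < r\<close> gh[of v] by (simp add: norm_mult)
          ultimately have "(\<rho> - r / 4) * cmod (h v) \<le> M"
            by (meson mult_right_mono norm_ge_zero order_trans)
          then show ?thesis using \<open>max _ _ < \<rho>\<close> by (simp add: field_simps)
        qed
      qed (use that in auto)
      then show ?thesis using that by (simp add: field_simps)
    qed
    then have "eventually (\<lambda>\<rho>. cmod (h w) * (\<rho> - r / 4) \<le> M) (at_left r)"
      using w r unfolding eventually_at_left_field
      by (intro exI[of _ "max (cmod w) (r / 4)"]) auto
    moreover have "((\<lambda>\<rho>. cmod (h w) * (\<rho> - r / 4)) \<longlongrightarrow> cmod (h w) * (r - r / 4)) (at_left r)"
      by (intro tendsto_intros)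
    ultimately have "cmod (h w) * (r - r / 4) \<le> M"
      by (intro tendsto_upperbound) auto
    then show ?thesis using r by (simp add: field_simps)
  qed
  have "h b = 0" if "b \<in> A" for b
    using insert.prems(5)[of b] gh[of b] insert.hyps that by auto
  then have hz: "cmod (h z) \<le> M * (4 / (3 * r)) * (2 / 3) ^ card A"
    using insert.prems holh bound by (intro insert.IH) auto
  \<comment> \<open>Restoring a zero costs at most r/2, removing it cost 4/(3 r): together the
    factor 2/3.\<close>
  have "cmod (z - a) \<le> r / 2"
    using norm_triangle_ineq4[of z a] a insert.prems(6) by simp
  then have "cmod (g z) \<le> r / 2 * (M * (4 / (3 * r)) * (2 / 3) ^ card A)"
    unfolding gh norm_mult using hz r by (intro mult_mono) auto
  then show ?case
    using insert.hyps r by (simp add: field_simps)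
qed

subsection \<open>Unitary flows with energy bounded below\<close>

text \<open>\<open>V t = exp (i t H)\<close> with \<open>H \<ge> c\<close>, the latter expressed through the graph of the generator.\<close>

locale semibounded_flow =
  fixes V :: "real \<Rightarrow> 'h::chilbert \<Rightarrow> 'h" and c :: real
  assumes V_unitary: "unitary (V t)"
    and V_zero: "V 0 x = x"
    and V_add: "V (s + t) x = V s (V t x)"
    and V_cont: "continuous_on UNIV (\<lambda>t. V t x)"
    and V_energy: "((\<lambda>t::real. inverse (\<i> * of_real t) *\<^sub>C (V t \<phi> - \<phi>)) \<longlongrightarrow> \<psi>) (at 0)
      \<Longrightarrow> c * (norm \<phi>)\<^sup>2 \<le> Re (cinner \<phi> \<psi>)"
begin

lemma V_contraction: "contraction (V t)"
  by (rule unitary_contraction[OF V_unitary])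

lemma norm_V [simp]: "norm (V t x) = norm x"
  by (rule unitary_norm[OF V_unitary])

lemma V_inverse [simp]: "V t (V (- t) x) = x" "V (- t) (V t x) = x"
  using V_add[of t "- t" x] V_add[of "- t" t x] by (simp_all add: V_zero)

lemma cinner_V: "cinner x (V t y) = cinner (V (- t) x) y"
  using unitary_cinner[OF V_unitary, of t "V (- t) x" y] by simp

lemma V_tendsto: "(s \<longlongrightarrow> t) G \<Longrightarrow> ((\<lambda>x. V (s x) y) \<longlongrightarrow> V t y) G"
  using V_cont continuous_on_tendsto_compose[of UNIV "\<lambda>t. V t y" s t G] by auto

end

lemma has_vector_derivative_of_quotient:
  fixes f :: "real \<Rightarrow> 'a::real_normed_vector"
  assumes "((\<lambda>t. (f (y + t) - f y) /\<^sub>R t) \<longlongrightarrow> D) (at 0)"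
  shows "(f has_vector_derivative D) (at y)"
  unfolding has_vector_derivative_def has_derivative_at
proof
  show "bounded_linear (\<lambda>t. t *\<^sub>R D)"
    by (rule bounded_linear_scaleR_left)
  have "((\<lambda>t. norm ((f (y + t) - f y) /\<^sub>R t - D)) \<longlongrightarrow> 0) (at 0)"
    using assms by (intro tendsto_norm_zero LIM_zero)
  moreover have "norm ((f (y + t) - f y) /\<^sub>R t - D) = norm (f (y + t) - f y - t *\<^sub>R D) / norm t"
    if "t \<noteq> 0" for t
  proof -
    have "(f (y + t) - f y) /\<^sub>R t - D = (f (y + t) - f y - t *\<^sub>R D) /\<^sub>R t"
      using that by (simp add: scaleR_diff_right)
    then show ?thesis by (simp add: divide_inverse mult.commute)
  qed
  ultimately show "(\<lambda>t. norm (f (y + t) - f y - t *\<^sub>R D) / norm t) \<midarrow>0\<rightarrow> 0"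
    by (elim Lim_transform_eventually) (auto simp: eventually_at_filter)
qed

section \<open>Entire functions with values in a Hilbert space\<close>

definition analytic_curve :: "(complex \<Rightarrow> 'a::chilbert) \<Rightarrow> bool" where
  "analytic_curve \<xi> \<longleftrightarrow> (\<forall>z. \<exists>D. ((\<lambda>h. inverse h *\<^sub>C (\<xi> (z + h) - \<xi> z)) \<longlongrightarrow> D) (at 0))"

lemma analytic_curve_const: "analytic_curve (\<lambda>_. x)"
  by (auto simp: analytic_curve_def)

lemma analytic_curve_diff:
  assumes "analytic_curve \<xi>" "analytic_curve \<eta>" shows "analytic_curve (\<lambda>z. \<xi> z - \<eta> z)"
  unfolding analytic_curve_def
proof
  fix z
  obtain D D' where "((\<lambda>h. inverse h *\<^sub>C (\<xi> (z + h) - \<xi> z)) \<longlongrightarrow> D) (at 0)"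
    "((\<lambda>h. inverse h *\<^sub>C (\<eta> (z + h) - \<eta> z)) \<longlongrightarrow> D') (at 0)"
    using assms unfolding analytic_curve_def by blast
  from tendsto_diff[OF this]
  have "((\<lambda>h. inverse h *\<^sub>C (\<xi> (z + h) - \<eta> (z + h) - (\<xi> z - \<eta> z))) \<longlongrightarrow> D - D') (at 0)"
    by (rule Lim_transform_eventually) (simp add: algebra_simps flip: scaleC_diff_right)
  then show "\<exists>D. ((\<lambda>h. inverse h *\<^sub>C (\<xi> (z + h) - \<eta> (z + h) - (\<xi> z - \<eta> z))) \<longlongrightarrow> D) (at 0)"
    by blast
qed

lemma analytic_curve_reflect:
  assumes "analytic_curve \<xi>" shows "analytic_curve (\<lambda>z. \<xi> (- z))"
  unfolding analytic_curve_def
proof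
  fix z
  obtain D where D: "((\<lambda>h. inverse h *\<^sub>C (\<xi> (- z + h) - \<xi> (- z))) \<longlongrightarrow> D) (at 0)"
    using assms unfolding analytic_curve_def by blast
  have "filterlim uminus (at 0) (at (0::complex))"
    by (auto simp: filterlim_at eventually_at_filter intro!: tendsto_eq_intros)
  from filterlim_compose[OF D this]
  have "((\<lambda>h. inverse (- h) *\<^sub>C (\<xi> (- z + - h) - \<xi> (- z))) \<longlongrightarrow> D) (at 0)" .
  from tendsto_scaleC[OF tendsto_const[of "-1"] this]
  show "\<exists>D. ((\<lambda>h. inverse h *\<^sub>C (\<xi> (- (z + h)) - \<xi> (- z))) \<longlongrightarrow> D) (at 0)"
    by (auto simp: scaleC_scaleC)
qed

lemma analytic_curve_tendsto:
  assumes "analytic_curve \<xi>" shows "((\<lambda>h. \<xi> (z + h)) \<longlongrightarrow> \<xi> z) (at 0)"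
proof -
  obtain D where D: "((\<lambda>h. inverse h *\<^sub>C (\<xi> (z + h) - \<xi> z)) \<longlongrightarrow> D) (at 0)"
    using assms unfolding analytic_curve_def by blast
  have "((\<lambda>h. h *\<^sub>C (inverse h *\<^sub>C (\<xi> (z + h) - \<xi> z)) + \<xi> z) \<longlongrightarrow> 0 *\<^sub>C D + \<xi> z) (at 0)"
    by (intro tendsto_add tendsto_scaleC D tendsto_ident_at tendsto_const)
  then have "((\<lambda>h. h *\<^sub>C (inverse h *\<^sub>C (\<xi> (z + h) - \<xi> z)) + \<xi> z) \<longlongrightarrow> \<xi> z) (at 0)" by simp
  then show ?thesis
    by (rule Lim_transform_eventually)
      (auto simp: eventually_at_filter scaleC_scaleC scaleC_one intro!: always_eventually)
qed

lemma analytic_curve_continuous: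
  assumes "analytic_curve \<xi>" shows "continuous_on S \<xi>"
proof -
  have "isCont \<xi> z" for z
    using analytic_curve_tendsto[OF assms, of z] by (simp add: isCont_iff)
  then show ?thesis by (simp add: continuous_at_imp_continuous_on)
qed

text \<open>Sesquilinear but not necessarily hermitian forms: closure under
  \<open>\<lambda>x y. cnj (Q y x)\<close> lets one extension lemma serve both the upper and the
  lower half plane.\<close>

definition contractive_form :: "('a::chilbert \<Rightarrow> 'a \<Rightarrow> complex) \<Rightarrow> bool" where
  "contractive_form Q \<longleftrightarrow>
     (\<forall>x y z. Q (x + y) z = Q x z + Q y z \<and> Q z (x + y) = Q z x + Q z y) \<and>
     (\<forall>a x y. Q (a *\<^sub>C x) y = cnj a * Q x y \<and> Q x (a *\<^sub>C y) = a * Q x y) \<and>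
     (\<forall>x y. cmod (Q x y) \<le> norm x * norm y)"

lemma contractive_form_bounded_bilinear: "contractive_form Q \<Longrightarrow> bounded_bilinear Q"
  by standard (auto simp: contractive_form_def scaleR_scaleC scaleR_conv_of_real intro!: exI[of _ 1])

lemma contractive_form_norm_le: "contractive_form Q \<Longrightarrow> cmod (Q x y) \<le> norm x * norm y"
  by (simp add: contractive_form_def)

lemma contractive_form_cinner: "contraction X \<Longrightarrow> contractive_form (\<lambda>x y. cinner x (X y))"
  unfolding contractive_form_def
proof (intro conjI allI)
  assume X: "contraction X"
  show "cmod (cinner x (X y)) \<le> norm x * norm y" for x y
    using cinner_norm_le[of x "X y"] contraction_norm_le[OF X, of y]
    by (meson mult_left_mono norm_ge_zero order_trans)
qed (simp_all add: cinner_add_left cinner_add_right cinner_scaleC_left cinner_scaleC_right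
    clinear_op_add clinear_op_scaleC contraction_clinear)

lemma contractive_form_cnj_swap: "contractive_form Q \<Longrightarrow> contractive_form (\<lambda>x y. cnj (Q y x))"
  by (auto simp: contractive_form_def) (metis mult.commute)

text \<open>Conjugate linearity in the first slot is undone by the antiholomorphic argument
  \<open>- cnj z\<close>. The minus sign preserves Im z, so the decay estimate remains applicable
  above the axis; on the real axis it produces V (- t).\<close>

lemma contractive_form_holomorphic:
  assumes Q: "contractive_form Q" and \<xi>: "analytic_curve \<xi>" and p: "analytic_curve p"
  shows "(\<lambda>z. Q (\<xi> (- cnj z)) (p z)) holomorphic_on S"
proof -
  interpret Q: bounded_bilinear Q by (rule contractive_form_bounded_bilinear[OF Q])
  have Qc: "Q (a *\<^sub>C x) y = cnj a * Q x y" "Q x (a *\<^sub>C y) = a * Q x y" for a x y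
    using Q by (auto simp: contractive_form_def)
  have "\<exists>D. ((\<lambda>z. Q (\<xi> (- cnj z)) (p z)) has_field_derivative D) (at z)" for z
  proof -
    obtain D1 where D1: "((\<lambda>h. inverse h *\<^sub>C (\<xi> (- cnj z + h) - \<xi> (- cnj z))) \<longlongrightarrow> D1) (at 0)"
      using \<xi> unfolding analytic_curve_def by blast
    obtain D2 where D2: "((\<lambda>h. inverse h *\<^sub>C (p (z + h) - p z)) \<longlongrightarrow> D2) (at 0)"
      using p unfolding analytic_curve_def by blast
    have flip: "filterlim (\<lambda>h. - cnj h) (at 0) (at 0)"
      by (auto simp: filterlim_at eventually_at_filter intro!: tendsto_eq_intros)
    note D1' = filterlim_compose[OF D1 flip]
    note c1 = filterlim_compose[OF analytic_curve_tendsto[OF \<xi>, of "- cnj z"] flip]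
    have "((\<lambda>h. Q (\<xi> (- cnj z + - cnj h)) (inverse h *\<^sub>C (p (z + h) - p z))
        - Q (inverse (- cnj h) *\<^sub>C (\<xi> (- cnj z + - cnj h) - \<xi> (- cnj z))) (p z))
        \<longlongrightarrow> Q (\<xi> (- cnj z)) D2 - Q D1 (p z)) (at 0)"
      by (intro tendsto_diff Q.tendsto c1 D2 D1' tendsto_const)
    moreover have "Q (\<xi> (- cnj z + - cnj h)) (inverse h *\<^sub>C (p (z + h) - p z))
        - Q (inverse (- cnj h) *\<^sub>C (\<xi> (- cnj z + - cnj h) - \<xi> (- cnj z))) (p z)
        = (Q (\<xi> (- cnj (z + h))) (p (z + h)) - Q (\<xi> (- cnj z)) (p z)) / h" if "h \<noteq> 0" for h
      using that by (simp add: Qc Q.diff_left Q.diff_right field_simps)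
    ultimately have "((\<lambda>h. (Q (\<xi> (- cnj (z + h))) (p (z + h)) - Q (\<xi> (- cnj z)) (p z)) / h)
        \<longlongrightarrow> Q (\<xi> (- cnj z)) D2 - Q D1 (p z)) (at 0)"
      by (elim Lim_transform_eventually) (auto simp: eventually_at_filter)
    then show ?thesis unfolding DERIV_def by blast
  qed
  then show ?thesis
    by (auto simp: holomorphic_on_def field_differentiable_def intro: has_field_derivative_at_within)
qed

section \<open>Analytic orbits and the energy estimate\<close>

context semibounded_flow
begin

text \<open>The model is \<open>\<xi> z\<close> = exp (i z H) (\<xi> 0), with \<open>\<xi> 0\<close>
  an entire vector of the generator H.\<close>

definition analytic_orbit :: "(complex \<Rightarrow> 'h) \<Rightarrow> bool" where
  "analytic_orbit \<xi> \<longleftrightarrow> analytic_curve \<xi> \<and> (\<forall>z t. \<xi> (z + of_real t) = V t (\<xi> z))"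

lemma analytic_orbit_real: "analytic_orbit \<xi> \<Longrightarrow> \<xi> (of_real t) = V t (\<xi> 0)"
  unfolding analytic_orbit_def by (metis add_0)

lemma analytic_orbit_norm: "analytic_orbit \<xi> \<Longrightarrow> norm (\<xi> z) = norm (\<xi> (\<i> * of_real (Im z)))"
proof -
  assume "analytic_orbit \<xi>"
  then have "\<xi> (\<i> * of_real (Im z) + of_real (Re z)) = V (Re z) (\<xi> (\<i> * of_real (Im z)))"
    unfolding analytic_orbit_def by blast
  moreover have "\<i> * of_real (Im z) + of_real (Re z) = z" by (simp add: complex_eq_iff)
  ultimately show ?thesis by simp
qed

text \<open>The only use of the spectrum condition: along an analytic orbit,
  \<open>d/dy \<parallel>\<xi> (x + i y)\<parallel>\<^sup>2 = - 2 \<langle>\<xi>, H \<xi>\<rangle> \<le> - 2 c \<parallel>\<xi>\<parallel>\<^sup>2\<close>.\<close>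

lemma analytic_orbit_decay:
  assumes \<xi>: "analytic_orbit \<xi>" and z: "0 \<le> Im z"
  shows "norm (\<xi> z) \<le> exp (- c * Im z) * norm (\<xi> 0)"
proof -
  define n where "n y = Re (cinner (\<xi> (\<i> * of_real y)) (\<xi> (\<i> * of_real y)))" for y :: real
  have deriv: "\<exists>D. (n has_real_derivative D) (at y) \<and> D \<le> - 2 * c * n y" for y
  proof -
    define w where "w = \<i> * complex_of_real y"
    \<comment> \<open>The complex derivative \<open>D\<close> is read in two directions: real
      increments identify D / i with H applied to \<open>\<xi> w\<close>, and imaginary increments
      give i D as the derivative in y.\<close>
    obtain D where D: "((\<lambda>h. inverse h *\<^sub>C (\<xi> (w + h) - \<xi> w)) \<longlongrightarrow> D) (at 0)"
      using \<xi> unfolding analytic_orbit_def analytic_curve_def by blast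
    have "filterlim complex_of_real (at 0) (at 0)"
      by (auto simp: filterlim_at eventually_at_filter intro!: tendsto_eq_intros)
    from filterlim_compose[OF D this]
    have "((\<lambda>t. inverse (of_real t) *\<^sub>C (V t (\<xi> w) - \<xi> w)) \<longlongrightarrow> D) (at 0)"
      using \<xi> unfolding analytic_orbit_def by simp
    from tendsto_scaleC[OF tendsto_const[of "inverse \<i>"] this]
    have "((\<lambda>t. inverse (\<i> * of_real t) *\<^sub>C (V t (\<xi> w) - \<xi> w)) \<longlongrightarrow> inverse \<i> *\<^sub>C D) (at 0)"
      by (simp add: scaleC_scaleC)
    from V_energy[OF this]
    have energy: "c * (norm (\<xi> w))\<^sup>2 \<le> Im (cinner (\<xi> w) D)"
      by (simp add: cinner_scaleC_right)
    have "filterlim (\<lambda>t. \<i> * complex_of_real t) (at 0) (at 0)"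
      by (auto simp: filterlim_at eventually_at_filter intro!: tendsto_eq_intros)
    from filterlim_compose[OF D this]
    have "((\<lambda>t. inverse (\<i> * of_real t) *\<^sub>C (\<xi> (w + \<i> * of_real t) - \<xi> w)) \<longlongrightarrow> D) (at 0)" .
    from tendsto_scaleC[OF tendsto_const[of "\<i>"] this]
    have "((\<lambda>t. (\<xi> (\<i> * of_real (y + t)) - \<xi> (\<i> * of_real y)) /\<^sub>R t) \<longlongrightarrow> \<i> *\<^sub>C D) (at 0)"
      by (simp add: scaleC_scaleC scaleR_scaleC w_def distrib_left)
    then have "((\<lambda>y. \<xi> (\<i> * of_real y)) has_vector_derivative \<i> *\<^sub>C D) (at y)"
      by (rule has_vector_derivative_of_quotient)
    then have "((\<lambda>y. cinner (\<xi> (\<i> * of_real y)) (\<xi> (\<i> * of_real y))) has_vector_derivative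
        (cinner (\<xi> w) (\<i> *\<^sub>C D) + cinner (\<i> *\<^sub>C D) (\<xi> w))) (at y)"
      unfolding w_def
      by (intro bounded_bilinear.has_vector_derivative[OF bounded_bilinear_cinner])
    then have "(n has_vector_derivative Re (cinner (\<xi> w) (\<i> *\<^sub>C D) + cinner (\<i> *\<^sub>C D) (\<xi> w))) (at y)"
      unfolding n_def by (rule bounded_linear.has_vector_derivative[OF bounded_linear_Re])
    moreover have "Re (cinner (\<xi> w) (\<i> *\<^sub>C D) + cinner (\<i> *\<^sub>C D) (\<xi> w)) = - 2 * Im (cinner (\<xi> w) D)"
      using cinner_commute[of D "\<xi> w"] by (simp add: cinner_scaleC_left cinner_scaleC_right)
    ultimately have "(n has_real_derivative - 2 * Im (cinner (\<xi> w) D)) (at y)"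
      by (simp add: has_real_derivative_iff_has_vector_derivative)
    moreover have "n y = (norm (\<xi> w))\<^sup>2" by (simp add: n_def w_def Re_cinner_self)
    ultimately show ?thesis using energy by (intro exI conjI) auto
  qed
  \<comment> \<open>Gronwall's integrating factor for n' \<le> - 2 c n.\<close>
  define g where "g y = exp (2 * c * y) * n y" for y
  have "g (Im z) \<le> g 0"
  proof (rule DERIV_nonpos_imp_nonincreasing[OF z])
    fix y
    obtain D where D: "(n has_real_derivative D) (at y)" "D \<le> - 2 * c * n y" using deriv by blast
    have "(g has_real_derivative exp (2 * c * y) * (2 * c) * n y + D * exp (2 * c * y)) (at y)"
      unfolding g_def by (auto intro!: derivative_eq_intros D(1))
    moreover have "exp (2 * c * y) * (2 * c) * n y + D * exp (2 * c * y) =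
        exp (2 * c * y) * (D - (- 2 * c * n y))" by (simp add: algebra_simps)
    moreover have "\<dots> \<le> 0" using D(2) by (simp add: mult_nonneg_nonpos)
    ultimately show "\<exists>D. (g has_real_derivative D) (at y) \<and> D \<le> 0" by auto
  qed
  moreover have "g (Im z) = (exp (c * Im z) * norm (\<xi> z))\<^sup>2"
    using analytic_orbit_norm[OF \<xi>, of z]
    by (simp add: g_def n_def Re_cinner_self power_mult_distrib mult.assoc exp_double)
  moreover have "g 0 = (norm (\<xi> 0))\<^sup>2" by (simp add: g_def n_def Re_cinner_self)
  ultimately have "(exp (c * Im z) * norm (\<xi> z))\<^sup>2 \<le> (norm (\<xi> 0))\<^sup>2" by simp
  then have "exp (c * Im z) * norm (\<xi> z) \<le> norm (\<xi> 0)"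
    by (rule power2_le_imp_le) simp
  then show ?thesis by (simp add: exp_minus field_simps)
qed

lemma analytic_orbit_decay_half_strip:
  assumes \<xi>: "analytic_orbit \<xi>" and z: "z \<in> half_strip"
  shows "norm (\<xi> z) \<le> exp \<bar>c\<bar> * norm (\<xi> 0)"
proof -
  have "- c * Im z \<le> \<bar>c\<bar> * \<bar>Im z\<bar>"
    by (metis abs_ge_self abs_minus_cancel abs_mult)
  also have "\<dots> \<le> \<bar>c\<bar>"
    using z by (intro mult_left_le) auto
  finally have "exp (- c * Im z) * norm (\<xi> 0) \<le> exp \<bar>c\<bar> * norm (\<xi> 0)"
    by (intro mult_right_mono) auto
  then show ?thesis
    using analytic_orbit_decay[OF \<xi>, of z] z by simp
qed

text \<open>The decay estimate is silent below the real axis, where the second arguments of the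
  forms are evaluated. As the norm depends on Im z only, a compact segment of the imaginary axis
  suffices.\<close>

lemma analytic_orbit_bounded:
  assumes \<xi>: "analytic_orbit \<xi>"
  obtains B where "0 \<le> B" "\<And>z. \<bar>Im z\<bar> \<le> 1 \<Longrightarrow> norm (\<xi> z) \<le> B"
proof -
  have "continuous_on UNIV \<xi>"
    using \<xi> unfolding analytic_orbit_def by (intro analytic_curve_continuous) simp
  then have "continuous_on {-1..1} (\<lambda>y. \<xi> (\<i> * of_real y))"
    by (rule continuous_on_compose2) (auto intro!: continuous_intros)
  then have "bounded ((\<lambda>y. \<xi> (\<i> * of_real y)) ` {-1..1::real})"
    by (intro compact_imp_bounded compact_continuous_image) auto
  then obtain B where B: "\<And>y. y \<in> {-1..1} \<Longrightarrow> norm (\<xi> (\<i> * of_real y)) \<le> B"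
    unfolding bounded_iff by blast
  moreover have "0 \<le> B" using order_trans[OF norm_ge_zero B[of 0]] by simp
  moreover have "norm (\<xi> z) \<le> B" if "\<bar>Im z\<bar> \<le> 1" for z
    using B[of "Im z"] that analytic_orbit_norm[OF \<xi>, of z] by (simp add: abs_le_iff)
  ultimately show ?thesis
    using that by blast
qed

lemma analytic_orbit_diff:
  "analytic_orbit \<xi> \<Longrightarrow> analytic_orbit \<eta> \<Longrightarrow> analytic_orbit (\<lambda>z. \<xi> z - \<eta> z)"
  unfolding analytic_orbit_def
  by (auto simp: analytic_curve_diff clinear_op_diff contraction_clinear[OF V_contraction])

end

subsection \<open>Gaussian smearing\<close>

lemma has_integral_translate_UNIV:
  fixes f :: "real \<Rightarrow> 'a::banach"
  assumes "(f has_integral i) UNIV"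
  shows "((\<lambda>t. f (t + s)) has_integral i) UNIV"
proof -
  have int: "f integrable_on cbox a b" for a b
    using assms by (auto simp: has_integral_alt'[of f])
  have shift: "integral (cbox a b) (\<lambda>t. f (t + s)) = integral (cbox (a + s) (b + s)) f" for a b
    using integral_shift_cbox[of "a + s" s "b + s" f] by simp
  have "(\<lambda>t. f (t + s)) integrable_on cbox a b" for a b
    using integrable_shift_cbox[OF int[of "a + s" "b + s"], of s] by simp
  moreover have "\<exists>B>0. \<forall>a b. ball 0 B \<subseteq> cbox a b \<longrightarrow>
      norm (integral (cbox a b) (\<lambda>t. f (t + s)) - i) < e" if "e > 0" for e
  proof -
    have "\<forall>e>0. \<exists>B>0. \<forall>a b. ball 0 B \<subseteq> cbox a b \<longrightarrow> norm (integral (cbox a b) f - i) < e"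
      using assms unfolding has_integral_alt'[of f] by simp
    then obtain B where B: "B > 0"
      and Bi: "\<And>a b. ball 0 B \<subseteq> cbox a b \<Longrightarrow> norm (integral (cbox a b) f - i) < e"
      using \<open>e > 0\<close> by blast
    have "ball 0 B \<subseteq> cbox (a + s) (b + s)" if sub: "ball 0 (B + \<bar>s\<bar>) \<subseteq> cbox a b" for a b
    proof
      fix x :: real assume "x \<in> ball 0 B"
      then have "x - s \<in> ball 0 (B + \<bar>s\<bar>)" by simp
      then have "x - s \<in> cbox a b" using sub by blast
      then show "x \<in> cbox (a + s) (b + s)" by auto
    qed
    then show ?thesis
      using B Bi unfolding shift by (intro exI[of _ "B + \<bar>s\<bar>"] conjI allI impI) (simp, blast)
  qed
  ultimately show ?thesis
    unfolding has_integral_alt'[of "\<lambda>t. f (t + s)"] by simp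
qed

lemma integrable_UNIV_dominated:
  fixes f :: "real \<Rightarrow> 'a::banach"
  assumes f: "continuous_on UNIV f" and g: "g integrable_on UNIV" and le: "\<And>t. norm (f t) \<le> g t"
  shows "f integrable_on UNIV"
  using f by (intro integrable_on_all_intervals_integrable_bound[OF _ le g])
    (auto intro!: integrable_continuous_interval elim: continuous_on_subset)

definition gauss :: "real \<Rightarrow> complex \<Rightarrow> complex" where
  "gauss \<sigma> w = exp (- (w\<^sup>2) / of_real (2 * \<sigma>\<^sup>2)) / of_real (sqrt (2 * pi * \<sigma>\<^sup>2))"

lemma gauss_of_real: "gauss \<sigma> (of_real t) = of_real (normal_density 0 \<sigma> t)"
  by (simp add: gauss_def normal_density_def exp_of_real flip: of_real_power of_real_minus
      of_real_divide of_real_mult)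

text \<open>Doubling the width leaves a surplus of Gaussian decay, which absorbs both the complex
  shift and the exponential growth in t.\<close>

lemma gauss_dominated:
  assumes \<sigma>: "\<sigma> > 0"
  shows "\<exists>C\<ge>0. \<forall>t. cmod (gauss \<sigma> (of_real t - z)) * exp (R * \<bar>t\<bar>) \<le> C * normal_density 0 (2 * \<sigma>) t"
proof -
  \<comment> \<open>\<open>K\<close> is what remains after completing two squares, one for the real
    shift Re z and one for the growth rate \<open>R\<close>.\<close>
  define K where "K = ((Re z)\<^sup>2 + (Im z)\<^sup>2) / (2 * \<sigma>\<^sup>2) + 2 * (R\<^sup>2 * \<sigma>\<^sup>2)"
  define k where "k = sqrt (2 * pi * \<sigma>\<^sup>2)"
  define k' where "k' = sqrt (2 * pi * (2 * \<sigma>)\<^sup>2)"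
  have k: "k > 0" "k' > 0" using \<sigma> by (auto simp: k_def k'_def)
  have main: "cmod (gauss \<sigma> (of_real t - z)) * exp (R * \<bar>t\<bar>) \<le>
      (exp K * k' / k) * normal_density 0 (2 * \<sigma>) t" for t
  proof -
    have "R * \<bar>t\<bar> * (8 * \<sigma>\<^sup>2) \<le> t\<^sup>2 + 16 * \<sigma>\<^sup>2 * \<sigma>\<^sup>2 * R\<^sup>2"
      using zero_le_power2[of "\<bar>t\<bar> - 4 * \<sigma>\<^sup>2 * R"] by (simp add: power2_eq_square algebra_simps)
    moreover have "t\<^sup>2 / 2 - (Re z)\<^sup>2 \<le> (t - Re z)\<^sup>2"
      using zero_le_power2[of "t - 2 * Re z"] by (simp add: power2_eq_square algebra_simps)
    ultimately have "(R * \<bar>t\<bar> * (8 * \<sigma>\<^sup>2) - 4 * ((t - Re z)\<^sup>2 - (Im z)\<^sup>2)) / (8 * \<sigma>\<^sup>2) \<le>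
        (4 * ((Re z)\<^sup>2 + (Im z)\<^sup>2) + 16 * \<sigma>\<^sup>2 * \<sigma>\<^sup>2 * R\<^sup>2 - t\<^sup>2) / (8 * \<sigma>\<^sup>2)"
      by (intro divide_right_mono) auto
    then have "- ((t - Re z)\<^sup>2 - (Im z)\<^sup>2) / (2 * \<sigma>\<^sup>2) + R * \<bar>t\<bar> \<le> K - t\<^sup>2 / (2 * (2 * \<sigma>)\<^sup>2)"
      using \<sigma> by (simp add: K_def add_divide_distrib diff_divide_distrib)
    moreover have "cmod (gauss \<sigma> (of_real t - z)) = exp (- ((t - Re z)\<^sup>2 - (Im z)\<^sup>2) / (2 * \<sigma>\<^sup>2)) / k"
      by (simp add: gauss_def norm_divide k_def Re_divide_of_real Re_power2 diff_divide_distrib flip: of_real_mult of_real_power)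
    ultimately have "cmod (gauss \<sigma> (of_real t - z)) * exp (R * \<bar>t\<bar>)
        \<le> exp (K - t\<^sup>2 / (2 * (2 * \<sigma>)\<^sup>2)) / k"
      using k by (simp add: divide_right_mono flip: exp_add)
    also have "\<dots> = (exp K * k' / k) * normal_density 0 (2 * \<sigma>) t"
    proof -
      have "normal_density 0 (2 * \<sigma>) t = exp (- (t\<^sup>2 / (2 * (2 * \<sigma>)\<^sup>2))) / k'"
        by (simp add: normal_density_def k'_def)
      moreover have "exp (K - t\<^sup>2 / (2 * (2 * \<sigma>)\<^sup>2)) = exp K * exp (- (t\<^sup>2 / (2 * (2 * \<sigma>)\<^sup>2)))"
        by (simp flip: exp_add)
      ultimately show ?thesis using k by simp
    qed
    finally show ?thesis .
  qed
  moreover have "0 \<le> exp K * k' / k" using k by simp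
  ultimately show ?thesis by blast
qed

text \<open>The remainder has the form |h| times an integrable function of t, so differentiation
  passes under the smearing integral, in norm.\<close>

lemma gauss_difference_quotient:
  assumes \<sigma>: "\<sigma> > 0"
  shows "\<exists>C\<ge>0. \<forall>t h. h \<noteq> 0 \<longrightarrow> cmod h \<le> 1 \<longrightarrow>
    cmod (inverse h * (gauss \<sigma> (of_real t - (z + h)) - gauss \<sigma> (of_real t - z))
      - gauss \<sigma> (of_real t - z) * (of_real t - z) / of_real (\<sigma>\<^sup>2))
    \<le> cmod h * (C * normal_density 0 (2 * \<sigma>) t)"
proof -
  \<comment> \<open>In \<open>b\<close>, 2 stems from the Taylor remainder of exp u through a^2
    \<le> 2 exp a, and 1 / (2 \<sigma>^2) from the quadratic part of \<open>u\<close>. The function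
    \<open>a\<close> bounds |u| / |h|; the resulting exp (2 a t) fixes the rate 2 / \<sigma>^2
    below.\<close>
  define b where "b = 2 + 1 / (2 * \<sigma>\<^sup>2)"
  define a where "a t = (\<bar>t\<bar> + cmod z + 1) / \<sigma>\<^sup>2" for t
  have a0: "0 \<le> a t" for t using \<sigma> by (simp add: a_def)
  have b0: "0 \<le> b" by (simp add: b_def)
  obtain C where C0: "C \<ge> 0" and
    C: "\<And>t. cmod (gauss \<sigma> (of_real t - z)) * exp (2 / \<sigma>\<^sup>2 * \<bar>t\<bar>) \<le> C * normal_density 0 (2 * \<sigma>) t"
    using gauss_dominated[OF \<sigma>, of z "2 / \<sigma>\<^sup>2"] by blast
  define C' where "C' = b * exp (2 * (cmod z + 1) / \<sigma>\<^sup>2) * C"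
  have "cmod (inverse h * (gauss \<sigma> (of_real t - (z + h)) - gauss \<sigma> (of_real t - z))
      - gauss \<sigma> (of_real t - z) * (of_real t - z) / of_real (\<sigma>\<^sup>2))
    \<le> cmod h * (C' * normal_density 0 (2 * \<sigma>) t)" if h: "h \<noteq> 0" "cmod h \<le> 1" for t h
  proof -
    define w where "w = of_real t - z"
    define u where "u = (w * h - h\<^sup>2 / 2) / of_real (\<sigma>\<^sup>2)"
    have "- ((w - h)\<^sup>2) / of_real (2 * \<sigma>\<^sup>2) = - (w\<^sup>2) / of_real (2 * \<sigma>\<^sup>2) + u"
      using \<sigma> by (simp add: u_def power2_eq_square field_simps)
    then have g: "gauss \<sigma> (w - h) = gauss \<sigma> w * exp u"
      by (simp only: gauss_def exp_add times_divide_eq_left)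
    have eq: "inverse h * (gauss \<sigma> (w - h) - gauss \<sigma> w) - gauss \<sigma> w * w / of_real (\<sigma>\<^sup>2)
        = gauss \<sigma> w * ((exp u - (1 + u)) / h - h / of_real (2 * \<sigma>\<^sup>2))"
      unfolding g using h \<sigma> by (simp add: u_def field_simps power2_eq_square)
    have nw: "cmod w \<le> \<bar>t\<bar> + cmod z"
      unfolding w_def using norm_triangle_ineq4[of "of_real t" z] by simp
    have u: "cmod u \<le> cmod h * a t"
    proof -
      have "u = h * ((w - h / 2) / of_real (\<sigma>\<^sup>2))"
        by (simp add: u_def power2_eq_square algebra_simps)
      moreover have "cmod (w - h / 2) \<le> \<bar>t\<bar> + cmod z + 1"
        using norm_triangle_ineq4[of w "h / 2"] nw h by (simp add: norm_divide)
      ultimately show ?thesis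
        using \<sigma> by (simp add: a_def norm_mult norm_divide norm_power divide_right_mono mult_left_mono)
    qed
    have "cmod u \<le> a t"
      using u h a0[of t] by (meson mult_left_le_one_le norm_ge_zero order_trans)
    moreover have "cmod (exp u - (1 + u)) \<le> exp \<bar>Re u\<bar> * (cmod u)\<^sup>2"
      using Taylor_exp[of u 1] by (simp add: power2_eq_square)
    ultimately have "cmod (exp u - (1 + u)) \<le> exp (a t) * (cmod h * a t)\<^sup>2"
      using u abs_Re_le_cmod[of u] by (elim order_trans) (intro mult_mono power_mono; simp)
    then have "cmod (exp u - (1 + u)) / cmod h \<le> cmod h * (exp (a t) * (a t)\<^sup>2)"
      using h by (simp add: field_simps power2_eq_square)
    also have "exp (a t) * (a t)\<^sup>2 \<le> exp (a t) * (2 * exp (a t))"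
      using exp_lower_Taylor_quadratic[OF a0[of t]] a0[of t] by (intro mult_left_mono) auto
    also have "\<dots> = 2 * exp (2 * a t)"
      by (simp add: exp_double power2_eq_square)
    finally have "cmod (exp u - (1 + u)) / cmod h \<le> cmod h * (2 * exp (2 * a t))"
      by (simp add: mult_left_mono)
    moreover have "cmod h * 1 / (2 * \<sigma>\<^sup>2) \<le> cmod h * exp (2 * a t) / (2 * \<sigma>\<^sup>2)"
      using a0[of t] by (intro divide_right_mono mult_left_mono) auto
    then have "cmod h / (2 * \<sigma>\<^sup>2) \<le> cmod h * (1 / (2 * \<sigma>\<^sup>2) * exp (2 * a t))"
      by simp
    ultimately have "cmod ((exp u - (1 + u)) / h - h / of_real (2 * \<sigma>\<^sup>2)) \<le> cmod h * (b * exp (2 * a t))"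
      using norm_triangle_ineq4[of "(exp u - (1 + u)) / h" "h / of_real (2 * \<sigma>\<^sup>2)"]
      by (simp add: norm_divide b_def algebra_simps del: of_real_mult)
    then have "cmod (gauss \<sigma> w * ((exp u - (1 + u)) / h - h / of_real (2 * \<sigma>\<^sup>2)))
        \<le> cmod (gauss \<sigma> w) * (cmod h * (b * exp (2 * a t)))"
      unfolding norm_mult by (intro mult_left_mono) auto
    also have "\<dots> = cmod h * (b * exp (2 * (cmod z + 1) / \<sigma>\<^sup>2)
        * (cmod (gauss \<sigma> w) * exp (2 / \<sigma>\<^sup>2 * \<bar>t\<bar>)))"
      by (simp add: a_def mult_ac add_divide_distrib distrib_left flip: exp_add)
    also have "\<dots> \<le> cmod h * (C' * normal_density 0 (2 * \<sigma>) t)"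
      using C[of t] b0 unfolding C'_def w_def mult.assoc by (intro mult_left_mono) auto
    finally show ?thesis
      unfolding eq[symmetric] by (simp add: w_def algebra_simps)
  qed
  moreover have "0 \<le> C'" using C0 b0 by (simp add: C'_def)
  ultimately show ?thesis by blast
qed

lemma normal_density_integral:
  assumes "\<sigma> > 0"
  shows "(normal_density 0 \<sigma> has_integral 1) UNIV"
    and "((\<lambda>t. normal_density 0 \<sigma> t * t\<^sup>2) has_integral \<sigma>\<^sup>2) UNIV"
proof -
  show "(normal_density 0 \<sigma> has_integral 1) UNIV"
    using has_integral_integral_lborel[OF integrable_normal_density[of \<sigma> 0]] assms by simp
  have "has_bochner_integral lborel (\<lambda>t. normal_density 0 \<sigma> t * t\<^sup>2) (\<sigma>\<^sup>2)"
    using normal_moment_even[of \<sigma> 0 1] assms by (simp add: power2_eq_square mult_ac)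
  then show "((\<lambda>t. normal_density 0 \<sigma> t * t\<^sup>2) has_integral \<sigma>\<^sup>2) UNIV"
    by (metis has_bochner_integral_iff has_integral_integral_lborel)
qed

context semibounded_flow
begin

text \<open>Formally exp (i z H) applied to the Gaussian average of the orbit of \<open>x\<close>:
  the time shift is moved from the flow to the kernel, where it may be complex.\<close>

definition smear :: "real \<Rightarrow> 'h \<Rightarrow> complex \<Rightarrow> 'h" where
  "smear \<sigma> x z = integral UNIV (\<lambda>t. gauss \<sigma> (of_real t - z) *\<^sub>C V t x)"

lemma kernel_integrable:
  assumes \<sigma>: "\<sigma> > 0" and f: "continuous_on UNIV f"
    and le: "\<And>t. cmod (f t) \<le> C * normal_density 0 \<sigma> t"
  shows "(\<lambda>t. f t *\<^sub>C V t x) integrable_on UNIV"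
    and "norm (integral UNIV (\<lambda>t. f t *\<^sub>C V t x)) \<le> C * norm x"
proof -
  have g: "((\<lambda>t. C * normal_density 0 \<sigma> t * norm x) has_integral C * norm x) UNIV"
    using has_integral_mult_left[OF has_integral_mult_right[OF normal_density_integral(1)[OF \<sigma>], of C],
        of "norm x"] by simp
  have le': "norm (f t *\<^sub>C V t x) \<le> C * normal_density 0 \<sigma> t * norm x" for t
    using le[of t] by (simp add: mult_right_mono)
  show int: "(\<lambda>t. f t *\<^sub>C V t x) integrable_on UNIV"
    by (rule integrable_UNIV_dominated[OF continuous_on_scaleC[OF f V_cont] _ le'])
      (use g in \<open>rule has_integral_integrable\<close>)
  show "norm (integral UNIV (\<lambda>t. f t *\<^sub>C V t x)) \<le> C * norm x"
    using integral_norm_bound_integral[OF int has_integral_integrable[OF g] le']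
    unfolding integral_unique[OF g] .
qed

lemma smear_integrable:
  assumes \<sigma>: "\<sigma> > 0"
  shows "(\<lambda>t. gauss \<sigma> (of_real t - z) *\<^sub>C V t x) integrable_on UNIV"
proof -
  obtain C where C: "\<And>t. cmod (gauss \<sigma> (of_real t - z)) \<le> C * normal_density 0 (2 * \<sigma>) t"
    using gauss_dominated[OF \<sigma>, of z 0] by auto
  have "continuous_on UNIV (\<lambda>t. gauss \<sigma> (of_real t - z))"
    using \<sigma> unfolding gauss_def by (intro continuous_intros) auto
  from kernel_integrable(1)[OF _ this C] \<sigma> show ?thesis by simp
qed

lemma smear_translate:
  assumes \<sigma>: "\<sigma> > 0"
  shows "smear \<sigma> x (z + of_real s) = V s (smear \<sigma> x z)"
proof -
  have "((\<lambda>t. gauss \<sigma> (of_real t - (z + of_real s)) *\<^sub>C V t x) has_integral smear \<sigma> x (z + of_real s)) UNIV"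
    unfolding smear_def by (rule integrable_integral[OF smear_integrable[OF \<sigma>]])
  from has_integral_translate_UNIV[OF this, of s]
  have "((\<lambda>t. gauss \<sigma> (of_real t - z) *\<^sub>C V s (V t x)) has_integral smear \<sigma> x (z + of_real s)) UNIV"
    by (simp add: add.commute[of _ s] V_add)
  moreover have "(V s \<circ> (\<lambda>t. gauss \<sigma> (of_real t - z) *\<^sub>C V t x) has_integral V s (smear \<sigma> x z)) UNIV"
    unfolding smear_def
    by (intro has_integral_linear integrable_integral smear_integrable[OF \<sigma>]
        contraction_bounded_linear V_contraction)
  then have "((\<lambda>t. gauss \<sigma> (of_real t - z) *\<^sub>C V s (V t x)) has_integral V s (smear \<sigma> x z)) UNIV"
    by (simp add: o_def clinear_op_scaleC[OF contraction_clinear[OF V_contraction]])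
  ultimately show ?thesis
    by (rule has_integral_unique)
qed

lemma smear_analytic:
  assumes \<sigma>: "\<sigma> > 0"
  shows "analytic_curve (smear \<sigma> x)"
  unfolding analytic_curve_def
proof
  fix z
  define k where "k h t = gauss \<sigma> (of_real t - (z + h))" for h t
  define d where "d t = gauss \<sigma> (of_real t - z) * (of_real t - z) / of_real (\<sigma>\<^sup>2)" for t
  define D where "D = integral UNIV (\<lambda>t. d t *\<^sub>C V t x)"
  obtain C where C0: "C \<ge> 0" and C: "\<And>t h. h \<noteq> 0 \<Longrightarrow> cmod h \<le> 1 \<Longrightarrow>
      cmod (inverse h * (k h t - k 0 t) - d t) \<le> cmod h * C * normal_density 0 (2 * \<sigma>) t"
    using gauss_difference_quotient[OF \<sigma>, of z] unfolding k_def d_def by (auto simp: mult.assoc)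
  have kint: "(\<lambda>t. k h t *\<^sub>C V t x) integrable_on UNIV" for h
    unfolding k_def by (rule smear_integrable[OF \<sigma>])
  have cont: "continuous_on UNIV (\<lambda>t. inverse h * (k h t - k 0 t) - d t)" for h
    using \<sigma> unfolding k_def d_def gauss_def by (intro continuous_intros) auto
  have est: "norm (inverse h *\<^sub>C (smear \<sigma> x (z + h) - smear \<sigma> x z) - D) \<le> cmod h * C * norm x"
    if h: "h \<noteq> 0" "cmod h \<le> 1" for h
  proof -
    define q where "q t = (inverse h * (k h t - k 0 t) - d t) *\<^sub>C V t x" for t
    define p where "p t = inverse h *\<^sub>C (k h t *\<^sub>C V t x - k 0 t *\<^sub>C V t x)" for t
    have q: "q integrable_on UNIV" "norm (integral UNIV q) \<le> cmod h * C * norm x"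
      unfolding q_def using kernel_integrable[OF _ cont C[OF h]] \<sigma> by simp_all
    have p: "(p has_integral inverse h *\<^sub>C (smear \<sigma> x (z + h) - smear \<sigma> x z)) UNIV"
    proof -
      have "((\<lambda>t. k h t *\<^sub>C V t x - k 0 t *\<^sub>C V t x) has_integral (smear \<sigma> x (z + h) - smear \<sigma> x z)) UNIV"
        using has_integral_diff[OF integrable_integral[OF kint[of h]] integrable_integral[OF kint[of 0]]]
        by (simp add: smear_def k_def)
      from has_integral_linear[OF this
          bounded_bilinear.bounded_linear_right[OF bounded_bilinear_scaleC, of "inverse h"]]
      show ?thesis by (simp add: o_def p_def[abs_def])
    qed
    have "((\<lambda>t. p t - q t) has_integral
        inverse h *\<^sub>C (smear \<sigma> x (z + h) - smear \<sigma> x z) - integral UNIV q) UNIV"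
      by (intro has_integral_diff p integrable_integral q)
    moreover have "p t - q t = d t *\<^sub>C V t x" for t
      by (simp add: p_def q_def scaleC_diff_left scaleC_diff_right scaleC_scaleC right_diff_distrib)
    ultimately have "D = inverse h *\<^sub>C (smear \<sigma> x (z + h) - smear \<sigma> x z) - integral UNIV q"
      unfolding D_def by (simp add: integral_unique)
    then show ?thesis using q by simp
  qed
  have "((\<lambda>h. inverse h *\<^sub>C (smear \<sigma> x (z + h) - smear \<sigma> x z) - D) \<longlongrightarrow> 0) (at 0)"
  proof (rule Lim_null_comparison)
    show "\<forall>\<^sub>F h in at 0. norm (inverse h *\<^sub>C (smear \<sigma> x (z + h) - smear \<sigma> x z) - D) \<le> cmod h * C * norm x"
      unfolding eventually_at using est by (intro exI[of _ 1]) auto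
    show "((\<lambda>h. cmod h * C * norm x) \<longlongrightarrow> 0) (at 0)"
      by (auto intro!: tendsto_eq_intros)
  qed
  then show "\<exists>D. ((\<lambda>h. inverse h *\<^sub>C (smear \<sigma> x (z + h) - smear \<sigma> x z)) \<longlongrightarrow> D) (at 0)"
    using LIM_zero_iff by blast
qed

lemma smear_orbit: "\<sigma> > 0 \<Longrightarrow> analytic_orbit (smear \<sigma> x)"
  by (simp add: analytic_orbit_def smear_analytic smear_translate)

lemma analytic_orbit_dense:
  assumes e: "e > 0"
  obtains \<xi> where "analytic_orbit \<xi>" "norm (\<xi> 0 - x) < e"
proof -
  have "((\<lambda>t. V t x) \<longlongrightarrow> V 0 x) (at 0)"
    by (intro V_tendsto tendsto_ident_at)
  from tendstoD[OF this, of "e / 2"] e obtain d where d: "d > 0"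
    and near': "\<And>t. t \<noteq> 0 \<Longrightarrow> \<bar>t\<bar> < d \<Longrightarrow> norm (V t x - x) < e / 2"
    by (auto simp: eventually_at dist_norm V_zero)
  have near: "norm (V t x - x) \<le> e / 2" if "\<bar>t\<bar> < d" for t
    using near'[of t] that e by (cases "t = 0") (auto simp: V_zero)
  define p where "p = norm x + 1"
  have p: "p > 0" "norm x / p \<le> 1"
    by (simp_all add: p_def divide_le_eq_1 add_nonneg_pos)
  \<comment> \<open>The variance is chosen so that the tail term 2 |x| \<sigma>^2 / d^2 is at most e
    / 4; \<open>p\<close> instead of the norm of \<open>x\<close> avoids division by 0.\<close>
  define \<sigma> where "\<sigma> = sqrt (d\<^sup>2 * e / (8 * p))"
  have "d\<^sup>2 * e / (8 * p) > 0"
    using d e p by (intro divide_pos_pos mult_pos_pos) auto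
  then have \<sigma>: "\<sigma> > 0" "\<sigma>\<^sup>2 = d\<^sup>2 * e / (8 * p)"
    by (auto simp: \<sigma>_def)
  define g where "g = normal_density 0 \<sigma>"
  have g0: "0 \<le> g t" for t by (simp add: g_def)
  note gi = normal_density_integral[OF \<sigma>(1), folded g_def]
  have 1: "((\<lambda>t. g t *\<^sub>R V t x) has_integral smear \<sigma> x 0) UNIV"
    using integrable_integral[OF smear_integrable[OF \<sigma>(1), of 0 x]]
    by (simp add: smear_def gauss_of_real g_def scaleR_scaleC)
  have 2: "((\<lambda>t. g t *\<^sub>R x) has_integral 1 *\<^sub>R x) UNIV"
    by (rule has_integral_scaleR_left[OF gi(1)])
  have diff: "((\<lambda>t. g t *\<^sub>R (V t x - x)) has_integral smear \<sigma> x 0 - x) UNIV"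
    using has_integral_diff[OF 1 2] by (simp add: scaleR_diff_right)
  have bd: "((\<lambda>t. e / 2 * g t + 2 * norm x / d\<^sup>2 * (g t * t\<^sup>2)) has_integral
      e / 2 * 1 + 2 * norm x / d\<^sup>2 * \<sigma>\<^sup>2) UNIV"
    by (intro has_integral_add has_integral_mult_right gi)
  have "norm (g t *\<^sub>R (V t x - x)) \<le> e / 2 * g t + 2 * norm x / d\<^sup>2 * (g t * t\<^sup>2)" for t
  proof -
    \<comment> \<open>Chebyshev's trick: for |t| \<ge> d the trivial bound 2 |x| is multiplied by
      t^2 / d^2 \<ge> 1, so that the second moment controls the tails.\<close>
    have *: "norm (V t x - x) \<le> e / 2 + 2 * norm x / d\<^sup>2 * t\<^sup>2"
    proof (cases "\<bar>t\<bar> < d")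
      case True
      then show ?thesis using near[of t] by (auto intro: add_increasing2)
    next
      case False
      then have "d\<^sup>2 \<le> t\<^sup>2" using d by (metis abs_le_square_iff abs_of_pos not_less)
      then have "2 * norm x * 1 \<le> 2 * norm x * (t\<^sup>2 / d\<^sup>2)"
        using d by (intro mult_left_mono) auto
      then show ?thesis
        using norm_triangle_ineq4[of "V t x" x] e by simp
    qed
    then show ?thesis
      using mult_left_mono[OF * g0[of t]] g0[of t] by (simp add: distrib_left mult_ac)
  qed
  from integral_norm_bound_integral[OF has_integral_integrable[OF diff] has_integral_integrable[OF bd] this]
  have "norm (smear \<sigma> x 0 - x) \<le> e / 2 + 2 * norm x / d\<^sup>2 * \<sigma>\<^sup>2"
    unfolding integral_unique[OF diff] integral_unique[OF bd] by simp
  also have "2 * norm x / d\<^sup>2 * \<sigma>\<^sup>2 = e / 4 * (norm x / p)"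
    using d p unfolding \<sigma>(2) by (simp add: field_simps)
  also have "\<dots> \<le> e / 4 * 1"
    using e p by (intro mult_left_mono) auto
  finally have "norm (smear \<sigma> x 0 - x) < e"
    using e by simp
  then show ?thesis
    using that[OF smear_orbit[OF \<sigma>(1)]] by blast
qed

end

subsection \<open>Borchers' theorem\<close>

context semibounded_flow
begin

lemma orbit_sequence: "\<exists>\<xi>. (\<forall>n. analytic_orbit (\<xi> n)) \<and> (\<lambda>n. \<xi> n 0) \<longlonglongrightarrow> x"
proof -
  have "\<exists>\<xi>. analytic_orbit \<xi> \<and> norm (\<xi> 0 - x) < 1 / real (Suc n)" for n
    using analytic_orbit_dense[of "1 / real (Suc n)" x] by auto
  then obtain \<xi> where \<xi>: "\<And>n. analytic_orbit (\<xi> n)" "\<And>n. norm (\<xi> n 0 - x) < 1 / real (Suc n)"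
    by metis
  have "(\<lambda>n. \<xi> n 0 - x) \<longlonglongrightarrow> 0"
    using \<xi>(2) by (intro Lim_null_comparison[OF _ LIMSEQ_Suc[OF lim_1_over_n]] always_eventually allI
        less_imp_le)
  then have "(\<lambda>n. \<xi> n 0) \<longlonglongrightarrow> x"
    using LIM_zero_iff by blast
  with \<xi>(1) show ?thesis by blast
qed

text \<open>The vector \<open>w\<close> is approximated by analytic orbits; by the decay estimate the resulting entire
  functions converge uniformly on the strip.\<close>

lemma half_strip_extension:
  assumes Q: "contractive_form Q" and p: "analytic_curve p"
    and B: "\<And>z. z \<in> half_strip \<Longrightarrow> norm (p z) \<le> B"
  obtains u where "continuous_on half_strip u" "u holomorphic_on open_half_strip"
    "\<And>z. z \<in> half_strip \<Longrightarrow> cmod (u z) \<le> exp \<bar>c\<bar> * norm w * B"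
    "\<And>t. u (of_real t) = Q (V (- t) w) (p (of_real t))"
proof -
  interpret Q: bounded_bilinear Q by (rule contractive_form_bounded_bilinear[OF Q])
  obtain \<xi> where \<xi>: "\<And>n. analytic_orbit (\<xi> n)" and lim: "(\<lambda>n. \<xi> n 0) \<longlonglongrightarrow> w"
    using orbit_sequence[of w] by blast
  define f where "f n z = Q (\<xi> n (- cnj z)) (p z)" for n z
  have B0: "0 \<le> B" using order_trans[OF norm_ge_zero B[of 0]] by simp
  have hol: "f n holomorphic_on S" for n S
    unfolding f_def using \<xi> by (intro contractive_form_holomorphic Q p) (simp add: analytic_orbit_def)
  have bound: "cmod (Q (\<eta> (- cnj z)) (p z)) \<le> exp \<bar>c\<bar> * norm (\<eta> 0) * B"
    if "analytic_orbit \<eta>" "z \<in> half_strip" for \<eta> z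
    using that B0 by (intro order_trans[OF contractive_form_norm_le[OF Q]] mult_mono B
        analytic_orbit_decay_half_strip) auto
  have fdiff: "dist (f m z) (f n z) \<le> exp \<bar>c\<bar> * norm (\<xi> m 0 - \<xi> n 0) * B" if "z \<in> half_strip" for m n z
    using bound[OF analytic_orbit_diff[OF \<xi>[of m] \<xi>[of n]] that]
    by (simp add: f_def dist_norm Q.diff_left)
  have "uniformly_Cauchy_on half_strip f"
  proof (rule uniformly_Cauchy_onI)
    fix e :: real assume e: "e > 0"
    \<comment> \<open>\<open>B + 1\<close> keeps \<open>K\<close> positive when B = 0.\<close>
    define K where "K = exp \<bar>c\<bar> * (B + 1)"
    have K: "K > 0" using B0 by (simp add: K_def)
    have "Cauchy (\<lambda>n. \<xi> n 0)" using lim by (rule LIMSEQ_imp_Cauchy)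
    then obtain M where M: "\<And>m n. m \<ge> M \<Longrightarrow> n \<ge> M \<Longrightarrow> norm (\<xi> m 0 - \<xi> n 0) < e / K"
      using e K unfolding Cauchy_def dist_norm by (meson divide_pos_pos)
    have "dist (f m z) (f n z) < e" if "z \<in> half_strip" "m \<ge> M" "n \<ge> M" for z m n
    proof -
      have "dist (f m z) (f n z) \<le> K * norm (\<xi> m 0 - \<xi> n 0)"
        by (rule order_trans[OF fdiff[OF that(1)]])
          (simp add: K_def mult_ac mult_left_mono mult_right_mono)
      also have "\<dots> < e" using M[OF that(2,3)] K by (simp add: field_simps)
      finally show ?thesis .
    qed
    then show "\<exists>M. \<forall>x\<in>half_strip. \<forall>m\<ge>M. \<forall>n\<ge>M. dist (f m x) (f n x) < e" by blast
  qed
  then obtain u where u: "uniform_limit half_strip f u sequentially"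
    using Cauchy_uniformly_convergent uniformly_convergent_on_def by blast
  have pw: "(\<lambda>n. f n z) \<longlonglongrightarrow> u z" if "z \<in> half_strip" for z
    using tendsto_uniform_limitI[OF u that] .
  show ?thesis
  proof
    show "continuous_on half_strip u"
      using uniform_limit_theorem[OF _ u] holomorphic_on_imp_continuous_on[OF hol] by simp
    show "u holomorphic_on open_half_strip"
    proof (rule holomorphic_uniform_sequence[OF open_open_half_strip hol])
      fix z assume "z \<in> open_half_strip"
      then obtain d where "d > 0" "cball z d \<subseteq> open_half_strip"
        using open_open_half_strip open_contains_cball by blast
      moreover from this have "cball z d \<subseteq> half_strip" by auto
      ultimately show "\<exists>d>0. cball z d \<subseteq> open_half_strip \<and> uniform_limit (cball z d) f u sequentially"
        using uniform_limit_on_subset[OF u] by blast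
    qed
    show "cmod (u z) \<le> exp \<bar>c\<bar> * norm w * B" if z: "z \<in> half_strip" for z
    proof (rule LIMSEQ_le[OF tendsto_norm[OF pw[OF z]]])
      show "(\<lambda>n. exp \<bar>c\<bar> * norm (\<xi> n 0) * B) \<longlonglongrightarrow> exp \<bar>c\<bar> * norm w * B"
        by (intro tendsto_intros lim)
      show "\<exists>N. \<forall>n\<ge>N. cmod (f n z) \<le> exp \<bar>c\<bar> * norm (\<xi> n 0) * B"
        using bound[OF \<xi> z] by (auto simp: f_def)
    qed
    show "u (of_real t) = Q (V (- t) w) (p (of_real t))" for t
    proof (rule LIMSEQ_unique[OF pw])
      have "f n (of_real t) = Q (V (- t) (\<xi> n 0)) (p (of_real t))" for n
        using analytic_orbit_real[OF \<xi>, of n "- t"] by (simp add: f_def)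
      then show "(\<lambda>n. f n (of_real t)) \<longlonglongrightarrow> Q (V (- t) w) (p (of_real t))"
        by (simp add: Q.tendsto contraction_tendsto[OF V_contraction lim])
    qed simp
  qed
qed

text \<open>Above the axis the left V (t) corresponds to exp (- y H), bounded by the energy
  condition, so \<open>x\<close> is arbitrary. The right V (- t) corresponds to exp (y H), so its
  vector must start an analytic orbit. Symmetry of \<open>F\<close> moves it onto
  \<open>x\<close>.\<close>

lemma upper_extension:
  assumes X: "contraction X" and F: "symmetric_op F"
    and \<psi>: "analytic_orbit \<psi>" and B: "\<And>z. \<bar>Im z\<bar> \<le> 1 \<Longrightarrow> norm (\<psi> z) \<le> B"
  obtains u where "continuous_on half_strip u" "u holomorphic_on open_half_strip"
    "\<And>z. z \<in> half_strip \<Longrightarrow> cmod (u z) \<le> exp \<bar>c\<bar> * norm (F x) * B"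
    "\<And>t. u (of_real t) = cinner x (F (V t (X (V (- t) (\<psi> 0)))))"
proof -
  have p: "analytic_curve (\<lambda>z. \<psi> (- z))"
    using \<psi> by (intro analytic_curve_reflect) (simp add: analytic_orbit_def)
  have p_real: "\<psi> (- of_real t) = V (- t) (\<psi> 0)" for t
    using analytic_orbit_real[OF \<psi>, of "- t"] by simp
  have "norm (\<psi> (- z)) \<le> B" if "z \<in> half_strip" for z
    using that by (intro B) auto
  then obtain u where u: "continuous_on half_strip u" "u holomorphic_on open_half_strip"
    "\<And>z. z \<in> half_strip \<Longrightarrow> cmod (u z) \<le> exp \<bar>c\<bar> * norm (F x) * B"
    "\<And>t. u (of_real t) = cinner (V (- t) (F x)) (X (\<psi> (- of_real t)))"
    using half_strip_extension[OF contractive_form_cinner[OF X] p, of B "F x"] by blast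
  have "u (of_real t) = cinner x (F (V t (X (V (- t) (\<psi> 0)))))" for t
    using F by (simp add: u(4) p_real symmetric_op_def flip: cinner_V)
  with u(1-3) show ?thesis by (rule that)
qed

text \<open>Below the axis the roles of the two vectors are exchanged. Conjugating the values,
  swapping the arguments of the form and reflecting z reduce this to the upper strip.\<close>

lemma lower_extension:
  assumes X: "contraction X"
    and \<phi>: "analytic_orbit \<phi>" and B: "\<And>z. \<bar>Im z\<bar> \<le> 1 \<Longrightarrow> norm (\<phi> z) \<le> B"
  obtains l where "continuous_on (cnj ` half_strip) l" "l holomorphic_on cnj ` open_half_strip"
    "\<And>z. cnj z \<in> half_strip \<Longrightarrow> cmod (l z) \<le> exp \<bar>c\<bar> * norm y * B"
    "\<And>t. l (of_real t) = cinner (\<phi> 0) (V t (X (V (- t) y)))"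
proof -
  have p: "analytic_curve (\<lambda>z. \<phi> (- z))"
    using \<phi> by (intro analytic_curve_reflect) (simp add: analytic_orbit_def)
  have p_real: "\<phi> (- of_real t) = V (- t) (\<phi> 0)" for t
    using analytic_orbit_real[OF \<phi>, of "- t"] by simp
  have "norm (\<phi> (- z)) \<le> B" if "z \<in> half_strip" for z
    using that by (intro B) auto
  then obtain u where u: "continuous_on half_strip u" "u holomorphic_on open_half_strip"
    "\<And>z. z \<in> half_strip \<Longrightarrow> cmod (u z) \<le> exp \<bar>c\<bar> * norm y * B"
    "\<And>t. u (of_real t) = cnj (cinner (\<phi> (- of_real t)) (X (V (- t) y)))"
    using half_strip_extension[OF contractive_form_cnj_swap[OF contractive_form_cinner[OF X]] p,
        of B y] by blast
  have im: "cnj ` (cnj ` S) = S" for S by (simp add: image_image)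
  show ?thesis
  proof (rule that[of "cnj \<circ> u \<circ> cnj"])
    show "continuous_on (cnj ` half_strip) (cnj \<circ> u \<circ> cnj)"
      by (intro continuous_on_compose) (auto simp: im intro: u(1) continuous_intros)
    have "cnj ` open_half_strip = {z. - 1 < Im z} \<inter> {z. Im z < 0}"
      by (auto simp: image_cnj_conv_vimage_cnj)
    then have "open (cnj ` open_half_strip)"
      by (auto intro: open_Int open_halfspace_Im_lt open_halfspace_Im_gt)
    then show "cnj \<circ> u \<circ> cnj holomorphic_on cnj ` open_half_strip"
      by (intro holomorphic_on_compose_cnj_cnj) (simp_all only: im u(2))
  qed (use u(3,4) in \<open>auto simp: p_real cinner_V\<close>)
qed

text \<open>The commutation of \<open>F\<close> with \<open>V t X V (- t)\<close> makes the upper and the lower extension agree on a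
  real interval, so that they continue each other. The bound does not depend on \<open>X\<close>.\<close>

lemma bilateral_extension:
  assumes X: "contraction X" and F: "contraction F" "symmetric_op F"
    and \<phi>: "analytic_orbit \<phi>" "\<And>z. \<bar>Im z\<bar> \<le> 1 \<Longrightarrow> norm (\<phi> z) \<le> B"
    and \<psi>: "analytic_orbit \<psi>" "\<And>z. \<bar>Im z\<bar> \<le> 1 \<Longrightarrow> norm (\<psi> z) \<le> B"
    and B: "0 \<le> B" and r: "0 < r" "r \<le> 1"
    and comm: "\<And>t x. \<bar>t\<bar> < r \<Longrightarrow> F (V t (X (V (- t) x))) = V t (X (V (- t) (F x)))"
  obtains g where "g holomorphic_on ball 0 r" "\<And>z. z \<in> ball 0 r \<Longrightarrow> cmod (g z) \<le> exp \<bar>c\<bar> * B * B"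
    "\<And>t. \<bar>t\<bar> < r \<Longrightarrow> g (of_real t) = cinner (\<phi> 0) (F (V t (X (V (- t) (\<psi> 0)))))"
proof -
  have FB: "exp \<bar>c\<bar> * norm (F (\<phi> 0)) * B \<le> exp \<bar>c\<bar> * B * B"
    "exp \<bar>c\<bar> * norm (F (\<psi> 0)) * B \<le> exp \<bar>c\<bar> * B * B"
    using B by (intro mult_right_mono mult_left_mono order_trans[OF contraction_norm_le[OF F(1)]]
        \<phi>(2) \<psi>(2); simp)+
  obtain u where u: "continuous_on half_strip u" "u holomorphic_on open_half_strip"
    "\<And>z. z \<in> half_strip \<Longrightarrow> cmod (u z) \<le> exp \<bar>c\<bar> * norm (F (\<phi> 0)) * B"
    "\<And>t. u (of_real t) = cinner (\<phi> 0) (F (V t (X (V (- t) (\<psi> 0)))))"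
    using upper_extension[OF X F(2) \<psi>, of "\<phi> 0"] by blast
  obtain l where l: "continuous_on (cnj ` half_strip) l" "l holomorphic_on cnj ` open_half_strip"
    "\<And>z. cnj z \<in> half_strip \<Longrightarrow> cmod (l z) \<le> exp \<bar>c\<bar> * norm (F (\<psi> 0)) * B"
    "\<And>t. l (of_real t) = cinner (\<phi> 0) (V t (X (V (- t) (F (\<psi> 0)))))"
    using lower_extension[OF X \<phi>, of "F (\<psi> 0)"] by blast
  have Im1: "\<bar>Im z\<bar> < 1" if "z \<in> ball 0 r" for z
    using that r abs_Im_le_cmod[of z] by auto
  define g where "g z = (if Im z \<le> 0 then l z else u z)" for z
  have "g holomorphic_on ball 0 r"
    unfolding g_def
  proof (rule holomorphic_paste_real_axis)
    show "l holomorphic_on ball 0 r \<inter> {z. Im z < 0}"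
      using Im1 by (intro holomorphic_on_subset[OF l(2)])
        (fastforce simp: image_cnj_conv_vimage_cnj)
    show "u holomorphic_on ball 0 r \<inter> {z. 0 < Im z}"
      using Im1 by (intro holomorphic_on_subset[OF u(2)]) fastforce
    show "continuous_on (ball 0 r \<inter> {z. Im z \<le> 0}) l"
      using Im1 by (intro continuous_on_subset[OF l(1)])
        (fastforce simp: image_cnj_conv_vimage_cnj)
    show "continuous_on (ball 0 r \<inter> {z. 0 \<le> Im z}) u"
      using Im1 by (intro continuous_on_subset[OF u(1)]) fastforce
    show "l z = u z" if "z \<in> ball 0 r" "Im z = 0" for z
    proof -
      have z: "z = of_real (Re z)" using that(2) by (simp add: complex_eq_iff)
      have "\<bar>Re z\<bar> < r" using that(1) abs_Re_le_cmod[of z] by simp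
      then show ?thesis by (subst (1 2) z) (simp only: u(4) l(4) comm)
    qed
  qed simp
  moreover have "cmod (g z) \<le> exp \<bar>c\<bar> * B * B" if "z \<in> ball 0 r" for z
    using Im1[OF that] order_trans[OF u(3) FB(1), of z] order_trans[OF l(3) FB(2), of z]
    by (auto simp: g_def)
  moreover have "g (of_real t) = cinner (\<phi> 0) (F (V t (X (V (- t) (\<psi> 0)))))" if "\<bar>t\<bar> < r" for t
    using comm[OF that] by (simp add: g_def l(4))
  ultimately show ?thesis by (rule that)
qed

section \<open>Products of translated operators\<close>

definition translated :: "('h \<Rightarrow> 'h) \<Rightarrow> real \<Rightarrow> 'h \<Rightarrow> 'h" where
  "translated E s x = V s (E (V (- s) x))"

definition translated_prod :: "('h \<Rightarrow> 'h) \<Rightarrow> real list \<Rightarrow> 'h \<Rightarrow> 'h" where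
  "translated_prod E ss = foldr (\<lambda>s Y. translated E s \<circ> Y) ss id"

lemma translated_prod_Nil [simp]: "translated_prod E [] x = x"
  and translated_prod_Cons [simp]:
    "translated_prod E (s # ss) x = translated E s (translated_prod E ss x)"
  by (simp_all add: translated_prod_def)

lemma translated_contraction: "contraction E \<Longrightarrow> contraction (translated E s)"
  using contraction_comp[OF V_contraction contraction_comp[OF _ V_contraction], of E s "- s"]
  by (simp add: o_def translated_def[abs_def])

lemma translated_prod_contraction: "contraction E \<Longrightarrow> contraction (translated_prod E ss)"
  by (induction ss)
    (simp_all add: translated_prod_def contraction_id contraction_comp translated_contraction)

lemma translated_translated: "translated (translated E s) t = translated E (t + s)"
proof -
  have "- (t + s) = - s + - t" by simp
  then have "V (- (t + s)) x = V (- s) (V (- t) x)" for x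
    by (simp only: V_add)
  then show ?thesis by (simp add: translated_def fun_eq_iff V_add del: minus_add_distrib)
qed

lemma translated_translated_prod:
  "translated (translated_prod E ss) t x = translated_prod E (map ((+) t) ss) x"
proof (induction ss arbitrary: x)
  case Nil
  then show ?case by (simp add: translated_def)
next
  case (Cons s ss)
  have "translated (translated_prod E (s # ss)) t x
      = translated (translated E s) t (translated (translated_prod E ss) t x)"
    by (simp add: translated_def)
  also have "\<dots> = translated_prod E (map ((+) t) (s # ss)) x"
    by (simp only: Cons translated_translated list.map translated_prod_Cons)
  finally show ?case .
qed

text \<open>Joint continuity is needed because in a nested product the shift and the vector vary
  together; it holds since every \<open>V t\<close> is an isometry.\<close>

lemma translated_tendsto:
  assumes E: "contraction E" and s: "s \<longlonglongrightarrow> s0" and y: "y \<longlonglongrightarrow> y0"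
  shows "(\<lambda>n. translated E (s n) (y n)) \<longlonglongrightarrow> translated E s0 y0"
proof -
  have V_lim: "(\<lambda>n. V (t n) (z n)) \<longlonglongrightarrow> V t0 z0" if t: "t \<longlonglongrightarrow> t0" and z: "z \<longlonglongrightarrow> z0" for t t0 z z0
  proof -
    have *: "norm (V (t n) (z n) - V (t n) z0) = norm (z n - z0)" for n
      by (simp flip: clinear_op_diff[OF contraction_clinear[OF V_contraction]])
    have "(\<lambda>n. norm (z n - z0)) \<longlonglongrightarrow> 0"
      using z by (intro tendsto_norm_zero LIM_zero)
    then have "(\<lambda>n. V (t n) (z n) - V (t n) z0) \<longlonglongrightarrow> 0"
      unfolding *[symmetric] by (rule tendsto_norm_zero_cancel)
    from tendsto_add[OF this V_tendsto[OF t, of z0]] show ?thesis by simp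
  qed
  show ?thesis
    unfolding translated_def by (intro V_lim s y contraction_tendsto[OF E] tendsto_minus)
qed

text \<open>Write \<open>E (t) = V t E V (- t)\<close> and consider \<open>t \<mapsto> F E (t + s\<^sub>1) \<cdots> E (t + s\<^sub>k)\<close> with
  distinct small shifts: it vanishes at each \<open>t = - s\<^sub>i\<close> because \<open>E F = 0\<close>, and its analytic
  continuation is bounded independently of \<open>k\<close> and of the shifts. Letting the shifts tend to 0
  turns the \<open>k\<close> zeros into a bound \<open>M (2/3)\<^sup>k\<close> for \<open>F E (t)\<close>.\<close>

theorem Borchers:
  assumes E: "contraction E" and idem: "\<And>x. E (E x) = E x"
    and F: "contraction F" "symmetric_op F"
    and orth: "\<And>x. E (F x) = 0"
    and \<epsilon>: "\<epsilon> > 0" and comm: "\<And>s x. \<bar>s\<bar> < \<epsilon> \<Longrightarrow> F (translated E s x) = translated E s (F x)"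
  shows "F (translated E t x) = 0"
proof -
  let ?P = "translated_prod E"
  \<comment> \<open>For |t| < r and shifts below r/4 the sum stays below \<open>\<epsilon>\<close>,
    so all factors commute with \<open>F\<close>.\<close>
  define r where "r = min (\<epsilon> / 2) 1"
  have r: "0 < r" "r \<le> 1" "r \<le> \<epsilon> / 2" using \<epsilon> by (auto simp: r_def)
  note E0 = clinear_op_zero[OF contraction_clinear[OF translated_contraction[OF E]]]
  have commP: "F (?P ss x) = ?P ss (F x)" if "\<forall>s\<in>set ss. \<bar>s\<bar> < \<epsilon>" for ss x
    using that by (induction ss) (auto simp: comm)
  \<comment> \<open>\<open>F\<close> is moved to the right until it meets the factor with shift 0,
    where E F = 0.\<close>
  have zeroP: "F (?P ss x) = 0" if "\<forall>s\<in>set ss. \<bar>s\<bar> < \<epsilon>" "0 \<in> set ss" for ss x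
    using that
  proof (induction ss)
    case (Cons s ss)
    show ?case
    proof (cases "s = 0")
      case True
      then show ?thesis using \<epsilon> comm[of 0] orth by (simp add: translated_def V_zero)
    next
      case False
      then show ?thesis using Cons by (simp add: comm E0)
    qed
  qed simp
  \<comment> \<open>Idempotence collapses equal factors, so the limit of coinciding shifts is a
    single translate of \<open>E\<close> however many factors there were.\<close>
  have powP: "?P (map (\<lambda>_. t) is) x = translated E t x" if "is \<noteq> []" for "is" :: "nat list" and t x
    using that by (induction "is" rule: list_nonempty_induct) (auto simp: translated_def idem)
  have orbit_zero: "cinner (\<phi> 0) (F (translated E t (\<psi> 0))) = 0"
    if \<phi>: "analytic_orbit \<phi>" and \<psi>: "analytic_orbit \<psi>" for \<phi> \<psi> t
  proof -
    obtain B1 where B1: "0 \<le> B1" "\<And>z. \<bar>Im z\<bar> \<le> 1 \<Longrightarrow> norm (\<phi> z) \<le> B1"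
      using analytic_orbit_bounded[OF \<phi>] by blast
    obtain B2 where B2: "0 \<le> B2" "\<And>z. \<bar>Im z\<bar> \<le> 1 \<Longrightarrow> norm (\<psi> z) \<le> B2"
      using analytic_orbit_bounded[OF \<psi>] by blast
    define B where "B = max B1 B2"
    have B: "0 \<le> B" "\<And>z. \<bar>Im z\<bar> \<le> 1 \<Longrightarrow> norm (\<phi> z) \<le> B" "\<And>z. \<bar>Im z\<bar> \<le> 1 \<Longrightarrow> norm (\<psi> z) \<le> B"
      using B1 B2 by (auto simp: B_def max.coboundedI1 max.coboundedI2)
    define M where "M = exp \<bar>c\<bar> * B * B"
    have power_bound: "cmod (cinner (\<phi> 0) (F (translated E t (\<psi> 0)))) \<le> M * (2 / 3) ^ k"
      if t: "\<bar>t\<bar> < r / 4" and k: "k > 0" for t k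
    proof -
      \<comment> \<open>The shifts \<open>a n * real i\<close> with i < k are distinct, smaller than
        r/4 by the denominator k + 1, and tend to 0 with n.\<close>
      define a where "a n = r / (4 * real (k + 1)) * inverse (real (Suc n))" for n
      define ss where "ss n = map (\<lambda>i. a n * real i) [0..<k]" for n
      have a_pos: "a n > 0" for n using r by (simp add: a_def)
      have ss_small: "\<bar>a n * real i\<bar> < r / 4" if "i < k" for n i
      proof -
        have "a n \<le> r / (4 * real (k + 1)) * 1"
          unfolding a_def using r by (intro mult_left_mono) (auto simp: inverse_le_1_iff)
        then have "a n * real i \<le> r / (4 * real (k + 1)) * real i"
          by (intro mult_right_mono) auto
        also have "\<dots> < r / (4 * real (k + 1)) * real (k + 1)"
          using that r by (intro mult_strict_left_mono) auto
        also have "\<dots> = r / 4" by (simp add: field_simps)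
        finally show ?thesis using a_pos[of n] by simp
      qed
      have bound: "cmod (cinner (\<phi> 0) (F (?P (map ((+) t) (ss n)) (\<psi> 0)))) \<le> M * (2 / 3) ^ k" for n
      proof -
        have small: "\<forall>s\<in>set (map ((+) t) (ss n)). \<bar>s\<bar> < \<epsilon>" if "\<bar>t\<bar> < r" for t
          using ss_small[of _ n] that r by (fastforce simp: ss_def)
        have *: "V t (?P (ss n) (V (- t) x)) = ?P (map ((+) t) (ss n)) x" for t x
          using translated_translated_prod by (simp add: translated_def)
        obtain g where g: "g holomorphic_on ball 0 r" "\<And>z. z \<in> ball 0 r \<Longrightarrow> cmod (g z) \<le> M"
          "\<And>t. \<bar>t\<bar> < r \<Longrightarrow> g (of_real t) = cinner (\<phi> 0) (F (?P (map ((+) t) (ss n)) (\<psi> 0)))"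
          using bilateral_extension[OF translated_prod_contraction[OF E, of "ss n"] F \<phi> B(2) \<psi> B(3) B(1) r(1,2)]
          unfolding * M_def using commP[OF small] by metis
        define A where "A = (\<lambda>i. complex_of_real (- (a n * real i))) ` {..<k}"
        have "inj_on (\<lambda>i. complex_of_real (- (a n * real i))) {..<k}"
          using a_pos[of n] by (auto simp: inj_on_def)
        then have cardA: "card A = k" "finite A" by (simp_all add: A_def card_image)
        have "g z = 0" if "z \<in> A" for z
        proof -
          obtain i where i: "i < k" "z = complex_of_real (- (a n * real i))"
            using \<open>z \<in> A\<close> by (auto simp: A_def)
          let ?t = "- (a n * real i)"
          have "0 \<in> set (map ((+) ?t) (ss n))" using i by (auto simp: ss_def image_iff)
          moreover have "\<bar>?t\<bar> < r" using ss_small[OF i(1), of n] r by simp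
          ultimately show ?thesis
            unfolding i(2) by (simp only: g(3) zeroP[OF small] cinner_zero_right)
        qed
        moreover have "A \<subseteq> ball 0 (r / 4)"
          using ss_small[of _ n] by (auto simp: A_def simp del: of_real_mult)
        ultimately have "cmod (g (of_real t)) \<le> M * (2 / 3) ^ card A"
          using t cardA r g by (intro holomorphic_bound_by_zeros) auto
        then show ?thesis using g(3)[of t] t r by (simp add: cardA)
      qed
      have "a \<longlonglongrightarrow> r / (4 * real (k + 1)) * 0"
        unfolding a_def by (intro tendsto_mult tendsto_const LIMSEQ_inverse_real_of_nat)
      then have a0: "a \<longlonglongrightarrow> 0" by simp
      have "(\<lambda>n. ?P (map (\<lambda>i. t + a n * real i) is) x) \<longlonglongrightarrow> ?P (map (\<lambda>_. t) is) x"
        for "is" :: "nat list" and x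
      proof (induction "is")
        case (Cons i "is")
        have "(\<lambda>n. t + a n * real i) \<longlonglongrightarrow> t + 0 * real i"
          by (intro tendsto_intros a0)
        then show ?case using translated_tendsto[OF E _ Cons] by simp
      qed simp
      from this[of "[0..<k]" "\<psi> 0"]
      have "(\<lambda>n. ?P (map ((+) t) (ss n)) (\<psi> 0)) \<longlonglongrightarrow> translated E t (\<psi> 0)"
        using k by (simp add: powP ss_def o_def)
      then have "(\<lambda>n. cmod (cinner (\<phi> 0) (F (?P (map ((+) t) (ss n)) (\<psi> 0)))))
          \<longlonglongrightarrow> cmod (cinner (\<phi> 0) (F (translated E t (\<psi> 0))))"
        by (intro tendsto_norm tendsto_cinner tendsto_const contraction_tendsto[OF F(1)])
      then show ?thesis
        by (rule LIMSEQ_le_const2) (use bound in blast)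
    qed
    have near_zero: "cinner (\<phi> 0) (F (translated E t (\<psi> 0))) = 0" if t: "\<bar>t\<bar> < r / 4" for t
    proof -
      have "(\<lambda>k. M * (2 / 3) ^ k) \<longlonglongrightarrow> M * 0"
        by (intro tendsto_mult tendsto_const LIMSEQ_power_zero) simp
      then have "cmod (cinner (\<phi> 0) (F (translated E t (\<psi> 0)))) \<le> M * 0"
        by (rule LIMSEQ_le_const) (use power_bound[OF t] in \<open>auto intro!: exI[of _ 1]\<close>)
      then show ?thesis by simp
    qed
    \<comment> \<open>To leave the small interval no commutation is required: the upper extension
      alone is determined by its boundary values there.\<close>
    obtain u where u: "continuous_on half_strip u" "u holomorphic_on open_half_strip"
      "\<And>z. z \<in> half_strip \<Longrightarrow> cmod (u z) \<le> exp \<bar>c\<bar> * norm (F (\<phi> 0)) * B"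
      "\<And>t. u (of_real t) = cinner (\<phi> 0) (F (V t (E (V (- t) (\<psi> 0)))))"
      using upper_extension[OF E F(2) \<psi> B(3), of "\<phi> 0"] by blast
    have "u (of_real t) = 0"
      by (rule half_strip_boundary_uniqueness[OF u(1,2), of "r / 4" 0])
        (use r near_zero in \<open>auto simp: u(4) translated_def\<close>)
    then show ?thesis by (simp add: u(4) translated_def)
  qed
  \<comment> \<open>Approximating the left vector towards the image \<open>y\<close> itself turns
    the vanishing matrix elements into <y, y> = 0.\<close>
  define y where "y = F (translated E t x)"
  obtain \<phi> where \<phi>: "\<And>n. analytic_orbit (\<phi> n)" "(\<lambda>n. \<phi> n 0) \<longlonglongrightarrow> y"
    using orbit_sequence[of y] by blast
  obtain \<psi> where \<psi>: "\<And>n. analytic_orbit (\<psi> n)" "(\<lambda>n. \<psi> n 0) \<longlonglongrightarrow> x"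
    using orbit_sequence[of x] by blast
  have "(\<lambda>n. F (translated E t (\<psi> n 0))) \<longlonglongrightarrow> y"
    unfolding y_def
    by (intro contraction_tendsto[OF F(1)] contraction_tendsto[OF translated_contraction[OF E]] \<psi>(2))
  from tendsto_cinner[OF \<phi>(2) this] have "cinner y y = 0"
    using orbit_zero[OF \<phi>(1) \<psi>(1)] by (simp add: LIMSEQ_const_iff)
  then show ?thesis
    by (simp add: cinner_self_norm y_def)
qed

lemma recurrence_vanishing:
  assumes r: "0 < r" and zero: "\<And>t. \<bar>t - t0\<bar> < r \<Longrightarrow> cinner x (V t x) = 0"
  shows "x = 0"
proof -
  obtain u where u: "continuous_on half_strip u" "u holomorphic_on open_half_strip"
    "\<And>z. z \<in> half_strip \<Longrightarrow> cmod (u z) \<le> exp \<bar>c\<bar> * norm x * norm x"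
    "\<And>t. u (of_real t) = cinner (V (- t) x) (id x)"
    using half_strip_extension[OF contractive_form_cinner[OF contraction_id]
        analytic_curve_const[of x] order_refl, of x] by blast
  have "u (of_real 0) = 0"
    by (rule half_strip_boundary_uniqueness[OF u(1,2) r, of t0]) (use zero in \<open>simp add: u(4) cinner_V\<close>)
  then show ?thesis
    unfolding u(4) by (simp add: V_zero cinner_self_norm)
qed

end

subsection \<open>Geometry of Minkowski space\<close>

lemma mink_form_add_left: "mink_form (x + y) z = mink_form x z + mink_form y z"
  and mink_form_add_right: "mink_form z (x + y) = mink_form z x + mink_form z y"
  and mink_form_diff_left: "mink_form (x - y) z = mink_form x z - mink_form y z"
  and mink_form_diff_right: "mink_form z (x - y) = mink_form z x - mink_form z y"
  and mink_form_scaleR_left: "mink_form (c *\<^sub>R x) y = c * mink_form x y"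
  and mink_form_scaleR_right: "mink_form x (c *\<^sub>R y) = c * mink_form x y"
  by (simp_all add: mink_form_def algebra_simps)

lemmas mink_form_linear = mink_form_add_left mink_form_add_right mink_form_diff_left
  mink_form_diff_right mink_form_scaleR_left mink_form_scaleR_right

lemma mink_form_commute: "mink_form x y = mink_form y x"
  by (simp add: mink_form_def mult.commute)

lemma abs_mink_form_le: "\<bar>mink_form x y\<bar> \<le> 4 * (norm x * norm y)"
proof -
  have "\<bar>x $ i * y $ i\<bar> \<le> norm x * norm y" for i
    unfolding abs_mult by (intro mult_mono component_le_norm_cart) auto
  from this[of 0] this[of 1] this[of 2] this[of 3] show ?thesis
    unfolding mink_form_def by linarith
qed

lemma norm_mink_square:
  fixes x :: mink
  shows "(norm x)\<^sup>2 = (x $ 0)\<^sup>2 + (x $ 1)\<^sup>2 + (x $ 2)\<^sup>2 + (x $ 3)\<^sup>2"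
proof -
  have "(norm x)\<^sup>2 = (\<Sum>i\<in>UNIV. (x $ i)\<^sup>2)"
    by (simp add: norm_vec_def L2_set_def sum_nonneg)
  \<comment> \<open>In the index type \<open>4\<close> arithmetic is modulo 4, so the last term of
    \<open>sum_4\<close>, at index 4, is the time component.\<close>
  moreover have "(4::4) = 0" by simp
  ultimately show ?thesis by (simp add: sum_4)
qed

lemma three_dim_Cauchy_Schwarz:
  fixes a :: real
  shows "(a * x + b * y + c * z)\<^sup>2 \<le> (a\<^sup>2 + b\<^sup>2 + c\<^sup>2) * (x\<^sup>2 + y\<^sup>2 + z\<^sup>2)"
proof -
  have "(a\<^sup>2 + b\<^sup>2 + c\<^sup>2) * (x\<^sup>2 + y\<^sup>2 + z\<^sup>2) - (a * x + b * y + c * z)\<^sup>2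
      = (a * y - b * x)\<^sup>2 + (a * z - c * x)\<^sup>2 + (b * z - c * y)\<^sup>2"
    by (simp add: power2_eq_square algebra_simps)
  then show ?thesis by (metis diff_ge_0_iff_ge sum_power2_ge_zero add_nonneg_nonneg zero_le_power2)
qed

text \<open>Orthogonality to \<open>n\<close> gives B \<le> (N / A) W by Cauchy-Schwarz in the space
  components; in the extremal case (W - B) / (W + B) equals \<kappa>. A quantitative bound is needed
  to absorb small timelike shifts.\<close>

lemma orthogonal_to_timelike:
  assumes "timelike n"
  obtains \<kappa> where "\<kappa> > 0" "\<And>v. mink_form n v = 0 \<Longrightarrow> mink_form v v \<le> - \<kappa> * (norm v)\<^sup>2"
proof -
  define A where "A = (n $ 0)\<^sup>2"
  define N where "N = (n $ 1)\<^sup>2 + (n $ 2)\<^sup>2 + (n $ 3)\<^sup>2"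
  have N: "0 \<le> N" "N < A"
    using assms by (auto simp: A_def N_def timelike_def mink_form_def power2_eq_square)
  define \<kappa> where "\<kappa> = (A - N) / (A + N)"
  have "mink_form v v \<le> - \<kappa> * (norm v)\<^sup>2" if v: "mink_form n v = 0" for v
  proof -
    define B where "B = (v $ 0)\<^sup>2"
    define W where "W = (v $ 1)\<^sup>2 + (v $ 2)\<^sup>2 + (v $ 3)\<^sup>2"
    have "n $ 0 * v $ 0 = n $ 1 * v $ 1 + n $ 2 * v $ 2 + n $ 3 * v $ 3"
      using v by (simp add: mink_form_def)
    then have "A * B \<le> N * W"
      using three_dim_Cauchy_Schwarz[of "n $ 1" "v $ 1" "n $ 2" "v $ 2" "n $ 3" "v $ 3"]
      by (simp add: A_def B_def N_def W_def flip: power_mult_distrib)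
    then have "(B - W) * (A + N) \<le> - ((A - N) * (B + W))"
      by (simp add: algebra_simps)
    then have "B - W \<le> - \<kappa> * (B + W)"
      using N by (simp add: \<kappa>_def field_simps)
    moreover have "mink_form v v = B - W"
      by (simp add: mink_form_def B_def W_def power2_eq_square)
    moreover have "(norm v)\<^sup>2 = B + W"
      by (simp add: norm_mink_square B_def W_def)
    ultimately show ?thesis by simp
  qed
  moreover have "\<kappa> > 0" using N by (simp add: \<kappa>_def)
  ultimately show ?thesis using that by blast
qed

lemma orthogonal_vector_exists:
  assumes n: "timelike n"
  obtains a where "mink_form n a = 0" "norm a \<ge> R"
proof -
  \<comment> \<open>Swapping the first two components of \<open>n\<close> makes the two products in
    the form cancel; b is nonzero since a timelike \<open>n\<close> has a nonzero time
    component.\<close>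
  define b :: mink where "b = (\<chi> i. if i = 0 then n $ 1 else if i = 1 then n $ 0 else 0)"
  have orth: "mink_form n b = 0"
    by (simp add: mink_form_def b_def)
  have "(n $ 0)\<^sup>2 \<noteq> 0"
    using n zero_le_square[of "n $ 1"] zero_le_square[of "n $ 2"] zero_le_square[of "n $ 3"]
    unfolding timelike_def mink_form_def power2_eq_square by linarith
  then have "b $ 1 \<noteq> 0"
    by (simp add: b_def)
  then have "b \<noteq> 0" by auto
  then show ?thesis
    using orth by (intro that[of "(\<bar>R\<bar> / norm b) *\<^sub>R b"]) (auto simp: mink_form_linear)
qed

text \<open>Without the shift \<open>t *\<^sub>R m\<close> the differences are long tangent vectors
  w with form at most - \<kappa> |w|^2, and the shift changes this by at most |t| L |w|^2.
  \<open>R\<close> does not depend on \<open>m\<close>, so one vector \<open>a\<close> serves all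
  timelike directions; only \<epsilon> varies.\<close>

lemma far_translates_spacelike_separated:
  assumes n: "timelike n" and D: "D \<subseteq> {x. mink_form n x = k}" "bounded D"
  obtains R where "\<And>a m. mink_form n a = 0 \<Longrightarrow> R \<le> norm a \<Longrightarrow>
    \<exists>\<epsilon>>0. \<forall>t. \<bar>t\<bar> < \<epsilon> \<longrightarrow> spacelike_separated D (translate D (a + t *\<^sub>R m))"
proof -
  obtain \<kappa> where \<kappa>: "\<kappa> > 0" "\<And>v. mink_form n v = 0 \<Longrightarrow> mink_form v v \<le> - \<kappa> * (norm v)\<^sup>2"
    using orthogonal_to_timelike[OF n] by blast
  obtain R where R: "\<And>x. x \<in> D \<Longrightarrow> norm x \<le> R"
    using D(2) unfolding bounded_iff by blast
  show ?thesis
  \<comment> \<open>This length forces |w| \<ge> 1 below, so that all error terms can be measured by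
    |w|^2.\<close>
  proof (rule that[of "2 * R + 1"])
    fix a m :: mink assume a: "mink_form n a = 0" "2 * R + 1 \<le> norm a"
    \<comment> \<open>8 |m| bounds the cross term, 4 |m|^2 the quadratic term (as t^2 \<le> |t|),
      and 1 keeps \<open>L\<close> positive.\<close>
    define L where "L = 8 * norm m + 4 * (norm m)\<^sup>2 + 1"
    have L: "L > 0" by (simp add: L_def add_nonneg_pos)
    define \<epsilon> where "\<epsilon> = min 1 (\<kappa> / L)"
    have "spacelike_separated D (translate D (a + t *\<^sub>R m))" if t: "\<bar>t\<bar> < \<epsilon>" for t
      unfolding spacelike_separated_def translate_def
    proof safe
      fix x y assume xy: "x \<in> D" "y \<in> D"
      define w where "w = x - y - a"
      have eq: "x - (y + (a + t *\<^sub>R m)) = w - t *\<^sub>R m" by (simp add: w_def)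
      have "mink_form n w = 0"
        using xy D(1) a(1) by (auto simp: w_def mink_form_linear)
      then have w1: "mink_form w w \<le> - \<kappa> * (norm w)\<^sup>2" by (rule \<kappa>(2))
      have "norm a \<le> norm w + (norm x + norm y)"
        using norm_triangle_ineq[of w a] norm_triangle_ineq4[of "x - y" w] norm_triangle_ineq4[of x y]
        by (simp add: w_def)
      then have nw: "1 \<le> norm w" using R[OF xy(1)] R[OF xy(2)] a(2) by linarith
      have t1: "\<bar>t\<bar> \<le> 1" "\<bar>t\<bar> * L < \<kappa>"
        using t L by (auto simp: \<epsilon>_def field_simps)
      have w_sq: "norm w \<le> (norm w)\<^sup>2" "1 \<le> (norm w)\<^sup>2"
        using nw by (auto simp: self_le_power one_le_power)
      have "- 2 * t * mink_form w m \<le> \<bar>2 * t * mink_form w m\<bar>" by (simp add: abs_if)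
      also have "\<dots> = 2 * \<bar>t\<bar> * \<bar>mink_form w m\<bar>" by (simp add: abs_mult)
      also have "\<dots> \<le> 2 * \<bar>t\<bar> * (4 * (norm w * norm m))"
        by (intro mult_left_mono abs_mink_form_le) auto
      also have "\<dots> \<le> 2 * \<bar>t\<bar> * (4 * ((norm w)\<^sup>2 * norm m))"
        using w_sq by (intro mult_left_mono mult_right_mono) auto
      finally have b1: "- 2 * t * mink_form w m \<le> \<bar>t\<bar> * (8 * norm m) * (norm w)\<^sup>2"
        by (simp add: mult_ac)
      have "t\<^sup>2 * mink_form m m \<le> \<bar>t\<bar> * (4 * (norm m)\<^sup>2)"
      proof -
        have "t\<^sup>2 * mink_form m m \<le> t\<^sup>2 * (4 * (norm m)\<^sup>2)"
          using abs_mink_form_le[of m m] by (intro mult_left_mono) (auto simp: power2_eq_square)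
        also have "t\<^sup>2 \<le> \<bar>t\<bar>"
          using t1(1) mult_left_le[of "\<bar>t\<bar>" "\<bar>t\<bar>"] by (simp add: power2_eq_square)
        finally show ?thesis by (simp add: mult_right_mono)
      qed
      also have "\<dots> \<le> \<bar>t\<bar> * (4 * (norm m)\<^sup>2) * (norm w)\<^sup>2"
        using mult_left_mono[OF w_sq(2), of "\<bar>t\<bar> * (4 * (norm m)\<^sup>2)"] by simp
      finally have "mink_form (w - t *\<^sub>R m) (w - t *\<^sub>R m)
          \<le> - \<kappa> * (norm w)\<^sup>2 + \<bar>t\<bar> * (8 * norm m) * (norm w)\<^sup>2 + \<bar>t\<bar> * (4 * (norm m)\<^sup>2) * (norm w)\<^sup>2"
        using w1 b1 mink_form_commute[of m w] by (simp add: mink_form_linear algebra_simps power2_eq_square)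
      also have "\<dots> \<le> (\<bar>t\<bar> * L - \<kappa>) * (norm w)\<^sup>2"
        by (simp add: L_def algebra_simps)
      also have "\<dots> < 0"
        using t1 w_sq(2) by (intro mult_neg_pos) auto
      finally show "spacelike (x - (y + (a + t *\<^sub>R m)))"
        unfolding eq spacelike_def .
    qed
    moreover have "\<epsilon> > 0" using \<kappa> L by (simp add: \<epsilon>_def)
    ultimately show "\<exists>\<epsilon>>0. \<forall>t. \<bar>t\<bar> < \<epsilon> \<longrightarrow> spacelike_separated D (translate D (a + t *\<^sub>R m))"
      by blast
  qed
qed

lemma timelike_multiple_of_future_unit:
  assumes q: "timelike q"
  obtains s m where "future_timelike_unit m" "q = s *\<^sub>R m" "s \<noteq> 0"
proof -
  define l where "l = sqrt (mink_form q q)"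
  have l: "l > 0" "l * l = mink_form q q" using q by (auto simp: l_def timelike_def)
  have "q $ 0 \<noteq> 0"
    using q zero_le_square[of "q $ 1"] zero_le_square[of "q $ 2"] zero_le_square[of "q $ 3"]
    unfolding timelike_def mink_form_def by fastforce
  \<comment> \<open>A past-directed \<open>q\<close> receives a negative factor, so that
    \<open>m\<close> is future-directed in either case.\<close>
  define s where "s = sgn (q $ 0) * l"
  have s: "s \<noteq> 0" "s * s = mink_form q q"
    using l \<open>q $ 0 \<noteq> 0\<close> by (auto simp: s_def sgn_if)
  have "mink_form q q \<noteq> 0" using q by (simp add: timelike_def)
  then have "mink_form ((1 / s) *\<^sub>R q) ((1 / s) *\<^sub>R q) = 1"
    by (simp add: mink_form_linear s flip: times_divide_eq_left) (simp add: field_simps s)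
  moreover have "((1 / s) *\<^sub>R q) $ 0 > 0"
    using l \<open>q $ 0 \<noteq> 0\<close> by (auto simp: s_def sgn_if field_simps)
  ultimately show ?thesis
    using s by (intro that[of "(1 / s) *\<^sub>R q" s]) (auto simp: future_timelike_unit_def)
qed

lemma translate_hyperplane:
  "translate {x. mink_form n x = k} b = {x. mink_form n x = k + mink_form n b}"
proof -
  have "x \<in> translate {x. mink_form n x = k} b" if "mink_form n x = k + mink_form n b" for x
    unfolding translate_def by (rule image_eqI[of _ _ "x - b"]) (use that in \<open>auto simp: mink_form_linear\<close>)
  then show ?thesis by (auto simp: translate_def mink_form_linear)
qed

subsection \<open>Absence of the eigenvalue 1\<close>

lemma rep_inverse:
  assumes "strongly_cont_unitary_rep U"
  shows "U (- b) (U b x) = x" "U b (U (- b) x) = x" "inv (U b) = U (- b)"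
proof -
  have U: "U (a + b) x = U a (U b x)" "U 0 x = x" for a b x
    using assms by (auto simp: strongly_cont_unitary_rep_def)
  show *: "U (- b) (U b x) = x" "U b (U (- b) x) = x" for b x
    using U(1)[of "- b" b x] U(1)[of b "- b" x] by (simp_all add: U(2))
  show "inv (U b) = U (- b)"
    by (rule inv_equality) (simp_all add: *)
qed

lemma rep_semibounded_flow:
  assumes rep: "strongly_cont_unitary_rep U" and bd: "generator_bounded_below U a"
  obtains c where "semibounded_flow (\<lambda>t. U (t *\<^sub>R a)) c"
proof -
  obtain c where c: "\<And>\<phi> \<psi>. generator U a \<phi> \<psi> \<Longrightarrow> c * (norm \<phi>)\<^sup>2 \<le> Re (cinner \<phi> \<psi>)"
    using bd unfolding generator_bounded_below_def by blast
  have "semibounded_flow (\<lambda>t. U (t *\<^sub>R a)) c"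
  proof
    show "continuous_on UNIV (\<lambda>t. U (t *\<^sub>R a) x)" for x
    proof (rule continuous_on_compose2[of UNIV "\<lambda>b. U b x"])
      show "continuous_on UNIV (\<lambda>b. U b x)"
        using rep by (simp add: strongly_cont_unitary_rep_def)
    qed (auto intro!: continuous_intros)
  qed (use rep c in \<open>auto simp: strongly_cont_unitary_rep_def generator_def scaleR_add_left\<close>)
  then show ?thesis by (rule that)
qed

theorem theorem3:
  fixes U :: "mink \<Rightarrow> 'h::chilbert \<Rightarrow> 'h"
    and Hyp :: "mink set set"
    and F :: "mink set \<Rightarrow> mink set set"
    and E :: "mink set \<Rightarrow> 'h \<Rightarrow> 'h"
  assumes rep: "strongly_cont_unitary_rep U"
    and spectrum: "\<And>a. future_timelike_unit a \<Longrightarrow> generator_bounded_below U a"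
    and foliation: "spacelike_foliation Hyp"
    and F_sub: "\<And>S D. S \<in> Hyp \<Longrightarrow> D \<in> F S \<Longrightarrow> D \<subseteq> S"
    and F_cover: "\<And>S. S \<in> Hyp \<Longrightarrow> \<exists>C \<subseteq> F S. (\<forall>D\<in>C. bounded D) \<and> \<Union>C = S"
    and F_transl: "\<And>S a. S \<in> Hyp \<Longrightarrow> F (translate S a) = (\<lambda>D. translate D a) ` F S"
    and E_effect: "\<And>S D. S \<in> Hyp \<Longrightarrow> D \<in> F S \<Longrightarrow> effect (E D)"
    and covariance: "\<And>S D a. S \<in> Hyp \<Longrightarrow> D \<in> F S \<Longrightarrow>
        E (translate D a) = U a \<circ> E D \<circ> inv (U a)"
    and localizability: "\<And>S D1 D2 \<phi>. S \<in> Hyp \<Longrightarrow> D1 \<in> F S \<Longrightarrow> D2 \<in> F S \<Longrightarrow>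
        D1 \<inter> D2 = {} \<Longrightarrow> norm \<phi> = 1 \<Longrightarrow> cinner \<phi> (E D1 \<phi>) = 1 \<Longrightarrow> cinner \<phi> (E D2 \<phi>) = 0"
    and local_comm: "\<And>S1 S2 D1 D2. S1 \<in> Hyp \<Longrightarrow> S2 \<in> Hyp \<Longrightarrow> D1 \<in> F S1 \<Longrightarrow> D2 \<in> F S2 \<Longrightarrow>
        spacelike_separated D1 D2 \<Longrightarrow> E D1 \<circ> E D2 = E D2 \<circ> E D1"
  shows "\<forall>S\<in>Hyp. \<forall>D\<in>F S. bounded D \<longrightarrow> eigenspace (E D) 1 = {0}"
proof (intro ballI impI)
  fix S D assume S: "S \<in> Hyp" and D: "D \<in> F S" "bounded D"
  obtain n where n: "timelike n" and Hyp: "Hyp = range (\<lambda>c::real. {x. mink_form n x = c})"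
    using foliation unfolding spacelike_foliation_def by blast
  obtain k where Sk: "S = {x. mink_form n x = k}" using S Hyp by blast
  have S_b: "translate S b \<in> Hyp" for b
    unfolding Sk translate_hyperplane Hyp by blast
  have D_b: "translate D b \<in> F (translate S b)" for b
    using F_transl[OF S] D(1) by auto
  note ED = E_effect[OF S D(1)] and EDb = E_effect[OF S_b D_b]
  note U_inv = rep_inverse[OF rep]
  have U_contr: "contraction (U b)" for b
    using rep by (auto simp: strongly_cont_unitary_rep_def intro: unitary_contraction)
  have U_add: "U (b + b') x = U b (U b' x)" for b b' x
    using rep by (auto simp: strongly_cont_unitary_rep_def)
  define P where "P b = eigenproj (E (translate D b))" for b
  have D0: "translate D 0 = D" by (simp add: translate_def)
  have P_conj: "P b x = U b (P 0 (U (- b) x))" for b x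
    unfolding P_def D0
    by (rule eigenproj_conj[OF ED U_contr U_inv(1) EDb]) (simp add: covariance[OF S D(1)] U_inv(3))
  obtain R where R: "\<And>a m. mink_form n a = 0 \<Longrightarrow> R \<le> norm a \<Longrightarrow>
      \<exists>\<epsilon>>0. \<forall>t. \<bar>t\<bar> < \<epsilon> \<longrightarrow> spacelike_separated D (translate D (a + t *\<^sub>R m))"
    using far_translates_spacelike_separated[OF n F_sub[OF S D(1), unfolded Sk] D(2)] by blast
  obtain a where a: "mink_form n a = 0" "norm a \<ge> R"
    using orthogonal_vector_exists[OF n] by blast
  have orth: "P a (P 0 x) = 0" for x
    unfolding P_def D0
  proof (rule eigenproj_orthogonal[OF ED EDb])
    have "spacelike_separated D (translate D a)"
    proof -
      obtain \<epsilon> where "\<epsilon> > 0" "\<forall>t. \<bar>t\<bar> < \<epsilon> \<longrightarrow> spacelike_separated D (translate D (a + t *\<^sub>R 0))"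
        using R[OF a] by blast
      then have "spacelike_separated D (translate D (a + (0::real) *\<^sub>R 0))"
        by (metis abs_zero)
      then show ?thesis by simp
    qed
    then have "D \<inter> translate D a = {}"
      unfolding spacelike_separated_def spacelike_def
      by (metis diff_self disjoint_iff mink_form_scaleR_left mult_zero_left order_less_irrefl scaleR_zero_left)
    \<comment> \<open>Since \<open>a\<close> is tangent to the hyperplane, the translate of
      \<open>D\<close> is again a spatial set of the same \<open>S\<close>, as localizability
      requires.\<close>
    moreover have "translate S a = S" by (simp add: Sk translate_hyperplane a)
    ultimately show "cinner \<phi> (E (translate D a) \<phi>) = 0"
      if "norm \<phi> = 1" "cinner \<phi> (E D \<phi>) = 1" for \<phi>
      using localizability[OF S D(1) _ _ that] D_b[of a] by simp
  qed
  have P_contr: "contraction (P b)" for b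
    unfolding P_def by (rule eigenproj_contraction[OF EDb])
  have P_sym: "symmetric_op (P b)" for b
    unfolding P_def by (rule eigenproj_symmetric[OF EDb])
  have P_idem: "P b (P b x) = P b x" for b x
    unfolding P_def by (rule eigenproj_idem[OF EDb])
  have vanish: "P 0 (P (a + t *\<^sub>R m) x) = 0" if m: "future_timelike_unit m" for m t x
  proof -
    obtain c where "semibounded_flow (\<lambda>t. U (t *\<^sub>R m)) c"
      using rep_semibounded_flow[OF rep spectrum[OF m]] .
    then interpret semibounded_flow "\<lambda>t. U (t *\<^sub>R m)" c .
    have tr: "translated (P a) s x = P (a + s *\<^sub>R m) x" for s x
    proof -
      have "U (a + s *\<^sub>R m) y = U (s *\<^sub>R m) (U a y)"
        "U (- (a + s *\<^sub>R m)) y = U (- a) (U (- (s *\<^sub>R m)) y)" for y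
        by (simp_all add: add.commute flip: U_add)
      then show ?thesis
        by (simp only: translated_def P_conj[of a] P_conj[of "a + s *\<^sub>R m"] scaleR_minus_left)
    qed
    obtain \<epsilon> where \<epsilon>: "\<epsilon> > 0"
      "\<And>t. \<bar>t\<bar> < \<epsilon> \<Longrightarrow> spacelike_separated D (translate D (a + t *\<^sub>R m))"
      using R[OF a, of m] by blast
    have "P 0 (translated (P a) t x) = 0"
    proof (rule Borchers[OF P_contr P_idem P_contr P_sym orth \<epsilon>(1)])
      fix s x assume "\<bar>s\<bar> < \<epsilon>"
      let ?b = "a + s *\<^sub>R m"
      have "E D (E (translate D ?b) y) = E (translate D ?b) (E D y)" for y
        using local_comm[OF S S_b D(1) D_b \<epsilon>(2)[OF \<open>\<bar>s\<bar> < \<epsilon>\<close>]] by (simp add: fun_eq_iff)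
      \<comment> \<open>Commutation passes from effects to projections one factor at a time: first
        the effect of \<open>D\<close> is replaced, then that of its translate.\<close>
      then have "P 0 (E (translate D ?b) y) = E (translate D ?b) (P 0 y)" for y
        unfolding P_def D0 by (intro eigenproj_commute[OF ED effect_contraction[OF EDb]])
      then have "P ?b (P 0 x) = P 0 (P ?b x)"
        unfolding P_def[of ?b] by (intro eigenproj_commute[OF EDb P_contr]) simp
      then show "P 0 (translated (P a) s x) = translated (P a) s (P 0 x)"
        by (simp add: tr)
    qed
    then show ?thesis by (simp add: tr)
  qed
  obtain s0 n' where n': "future_timelike_unit n'" "n = s0 *\<^sub>R n'" "s0 \<noteq> 0"
    using timelike_multiple_of_future_unit[OF n] by metis
  have n'a: "mink_form n' a = 0" using a(1) n'(2,3) by (simp add: mink_form_linear)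
  obtain c where "semibounded_flow (\<lambda>t. U (t *\<^sub>R n')) c"
    using rep_semibounded_flow[OF rep spectrum[OF n'(1)]] .
  then interpret semibounded_flow "\<lambda>t. U (t *\<^sub>R n')" c .
  have "x = 0" if x: "E D x = x" for x
  proof (rule recurrence_vanishing)
    \<comment> \<open>The centre |a.a| + 2 and radius 1 ensure t > |a.a| + 1, hence t^2 + a.a > 0,
      the value of the form on t n' - a.\<close>
    fix t assume "\<bar>t - (\<bar>mink_form a a\<bar> + 2)\<bar> < 1"
    then have t: "t > \<bar>mink_form a a\<bar> + 1" by (simp add: abs_less_iff)
    define q where "q = t *\<^sub>R n' - a"
    have "t * t \<ge> t * 1" using t by (intro mult_left_mono) auto
    moreover have "mink_form q q = t * t + mink_form a a"
      using n'(1) n'a mink_form_commute[of a n']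
      by (simp add: q_def mink_form_linear future_timelike_unit_def)
    ultimately have "timelike q"
      using t unfolding timelike_def by linarith
    then obtain s m where m: "future_timelike_unit m" "q = s *\<^sub>R m"
      using timelike_multiple_of_future_unit by metis
    \<comment> \<open>The direction \<open>m\<close> and its flow depend on \<open>t\<close>;
      \<open>s\<close> may be negative, which \<open>vanish\<close> permits.\<close>
    have b: "a + s *\<^sub>R m = t *\<^sub>R n'" using m(2) by (simp add: q_def algebra_simps)
    have Px: "P 0 x = x" by (simp add: P_def D0 eigenproj_fixed x)
    \<comment> \<open>By covariance the translated vector lies in the range of the translated
      projection, which \<open>P 0\<close> annihilates.\<close>
    have "P (t *\<^sub>R n') (U (t *\<^sub>R n') x) = U (t *\<^sub>R n') x"
      unfolding P_conj[of "t *\<^sub>R n'"] by (simp add: U_inv Px)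
    then have "P 0 (U (t *\<^sub>R n') x) = 0"
      using vanish[OF m(1), of s "U (t *\<^sub>R n') x"] by (simp add: b)
    moreover have "cinner x (U (t *\<^sub>R n') x) = cinner x (P 0 (U (t *\<^sub>R n') x))"
      using P_sym[of 0] Px unfolding symmetric_op_def by metis
    ultimately show "cinner x (U (t *\<^sub>R n') x) = 0" by simp
  qed simp
  then show "eigenspace (E D) 1 = {0}"
    by (auto simp: eigenspace_def scaleC_one clinear_op_zero[OF effect_clinear[OF ED]])
qed

end
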